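(* Let $G$ be a graph on the vertex set $[n]=\{1,\ldots,n\}$ and let $k$ be an integer with $0\le k\le n$. Then $G$ is $k$-connected if and only if $\beta_{i,i+1}(\mathbb{k}[\Delta(G)])=0$ for all integers $i\ge n-k$. In particular, $\kappa(G)=\max\{k\in\{0,\ldots,n\}\mid \beta_{i,i+1}(\mathbb{k}[\Delta(G)])=0\text{ for all } i\ge n-k\}$.
   Context: $\mathbb{k}$ is a field (of characteristic zero) and $R=\mathbb{k}[x_1,\ldots,x_n]$. For a simplicial complex $\Gamma$ on $[n]$, the Stanley–Reisner ideal $I_\Gamma$ is generated by the monomials $x_{i_1}\cdots x_{i_l}$ with $\{i_1,\ldots,i_l\}\notin\Gamma$, and the face ring is $\mathbb{k}[\Gamma]=R/I_\Gamma$. The clique complex $\Delta(G)$ of a graph $G$ is the simplicial complex whose faces are the vertex sets of cliques of $G$. $\beta_{i,j}(M)=\dim_{\mathbb{k}}\mathrm{Tor}_i^R(M,\mathbb{k})_j$ are the graded Betti numbers (standard $\mathbb{Z}$-grading with $\deg x_i=1$). A graph is $k$-connected if it has at least $k$ vertices and removing any set of fewer than $k$ vertices leaves a connected graph (every graph is $0$-connected); $\kappa(G)$ is the largest $k$ such that $G$ is $k$-connected. *)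

theory Defs
  imports Main "HOL-Library.Poly_Mapping"
begin

text \<open>Monomials are exponent vectors (finitely supported nat => nat); polynomials with coefficients
  in 'k are finitely supported maps from monomials to 'k (multiplication = convolution).
  The ring R = k[x_1,...,x_n] is the subring of polynomials only involving x_1..x_n.\<close>

type_synonym 'k mpoly = "(nat \<Rightarrow>\<^sub>0 nat) \<Rightarrow>\<^sub>0 'k"

definition poly_ring :: "nat \<Rightarrow> ('k::comm_ring_1) mpoly set" where
  "poly_ring n = {p. \<forall>m \<in> Poly_Mapping.keys p. Poly_Mapping.keys m \<subseteq> {1..n}}"

definition mon_deg :: "(nat \<Rightarrow>\<^sub>0 nat) \<Rightarrow> nat" where
  "mon_deg m = (\<Sum>i \<in> Poly_Mapping.keys m. Poly_Mapping.lookup m i)"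

text \<open>p is homogeneous of (integer) degree d; the zero polynomial is homogeneous of
  every degree, and a nonzero polynomial cannot have negative degree.\<close>
definition homogeneous :: "int \<Rightarrow> ('k::comm_ring_1) mpoly \<Rightarrow> bool" where
  "homogeneous d p = (\<forall>m \<in> Poly_Mapping.keys p. int (mon_deg m) = d)"

definition sqfree_monomial :: "nat set \<Rightarrow> ('k::comm_ring_1) mpoly" where
  "sqfree_monomial S = Poly_Mapping.single (\<Sum>i\<in>S. Poly_Mapping.single i 1) 1"

definition is_ideal_in :: "nat \<Rightarrow> ('k::comm_ring_1) mpoly set \<Rightarrow> bool" where
  "is_ideal_in n J = (J \<subseteq> poly_ring n \<and> 0 \<in> J \<and> (\<forall>p\<in>J. \<forall>q\<in>J. p + q \<in> J)
      \<and> (\<forall>r\<in>poly_ring n. \<forall>p\<in>J. r * p \<in> J))"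

definition ideal_gen :: "nat \<Rightarrow> ('k::comm_ring_1) mpoly set \<Rightarrow> 'k mpoly set" where
  "ideal_gen n S = \<Inter>{J. is_ideal_in n J \<and> S \<subseteq> J}"

text \<open>A simplicial complex on [n] is given as its set of faces (subsets of {1..n}).
  I_Gamma is generated by x_S for S \<subseteq> [n], S not a face.\<close>
definition SR_ideal :: "nat \<Rightarrow> nat set set \<Rightarrow> ('k::comm_ring_1) mpoly set" where
  "SR_ideal n \<Gamma> = ideal_gen n {sqfree_monomial S | S. S \<subseteq> {1..n} \<and> S \<notin> \<Gamma>}"

definition graph_on :: "nat \<Rightarrow> (nat \<Rightarrow> nat \<Rightarrow> bool) \<Rightarrow> bool" where
  "graph_on n E = ((\<forall>u v. E u v \<longrightarrow> u \<in> {1..n} \<and> v \<in> {1..n} \<and> u \<noteq> v)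
                  \<and> (\<forall>u v. E u v \<longrightarrow> E v u))"

definition clique_complex :: "nat \<Rightarrow> (nat \<Rightarrow> nat \<Rightarrow> bool) \<Rightarrow> nat set set" where
  "clique_complex n E = {S. S \<subseteq> {1..n} \<and> (\<forall>u\<in>S. \<forall>v\<in>S. u \<noteq> v \<longrightarrow> E u v)}"

text \<open>The induced subgraph on W is connected (the empty graph counts as connected).\<close>
definition connected_on :: "(nat \<Rightarrow> nat \<Rightarrow> bool) \<Rightarrow> nat set \<Rightarrow> bool" where
  "connected_on E W = (\<forall>u\<in>W. \<forall>v\<in>W. (\<lambda>a b. a \<in> W \<and> b \<in> W \<and> E a b)\<^sup>*\<^sup>* u v)"

definition k_connected :: "nat \<Rightarrow> (nat \<Rightarrow> nat \<Rightarrow> bool) \<Rightarrow> nat \<Rightarrow> bool" where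
  "k_connected n E k = (k \<le> n \<and>
     (\<forall>X. X \<subseteq> {1..n} \<and> card X < k \<longrightarrow> connected_on E ({1..n} - X)))"

definition vertex_connectivity :: "nat \<Rightarrow> (nat \<Rightarrow> nat \<Rightarrow> bool) \<Rightarrow> nat" where
  "vertex_connectivity n E = (GREATEST k. k_connected n E k)"

text \<open>A graded free resolution F of R/I: F_i = \<Oplus>_{c < rk i} R(-sh i c),
  differential d_i : F_i \<rightarrow> F_{i-1} (i \<ge> 1) given by the matrix dm i
  (entry (r,c) is the image of the c-th basis vector in the r-th coordinate).
  F_0 = R (rank 1, shift 0) and the image of d_1 is I, so coker d_1 = R/I.\<close>

type_synonym 'k gres =
  "(nat \<Rightarrow> nat) \<times> (nat \<Rightarrow> nat \<Rightarrow> nat) \<times> (nat \<Rightarrow> nat \<Rightarrow> nat \<Rightarrow> 'k mpoly)"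

definition rk :: "('k::zero) gres \<Rightarrow> nat \<Rightarrow> nat" where "rk F = fst F"
definition sh :: "('k::zero) gres \<Rightarrow> nat \<Rightarrow> nat \<Rightarrow> nat" where "sh F = fst (snd F)"
definition dm :: "('k::zero) gres \<Rightarrow> nat \<Rightarrow> nat \<Rightarrow> nat \<Rightarrow> 'k mpoly" where "dm F = snd (snd F)"

definition free_mod :: "nat \<Rightarrow> nat \<Rightarrow> (nat \<Rightarrow> ('k::comm_ring_1) mpoly) set" where
  "free_mod n b = {v. (\<forall>c<b. v c \<in> poly_ring n) \<and> (\<forall>c\<ge>b. v c = 0)}"

definition mat_app :: "(nat \<Rightarrow> nat \<Rightarrow> ('k::comm_ring_1) mpoly) \<Rightarrow> nat \<Rightarrow> nat
    \<Rightarrow> (nat \<Rightarrow> 'k mpoly) \<Rightarrow> (nat \<Rightarrow> 'k mpoly)" where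
  "mat_app A a b v = (\<lambda>r. if r < a then (\<Sum>c<b. A r c * v c) else 0)"

definition min_graded_free_res ::
    "nat \<Rightarrow> ('k::comm_ring_1) mpoly set \<Rightarrow> 'k gres \<Rightarrow> bool" where
  "min_graded_free_res n I F = (
     rk F 0 = 1 \<and> sh F 0 0 = 0 \<and>
     (\<forall>i\<ge>1. \<forall>r<rk F (i - 1). \<forall>c<rk F i.
        dm F i r c \<in> poly_ring n \<and>
        homogeneous (int (sh F i c) - int (sh F (i - 1) r)) (dm F i r c) \<and>
        Poly_Mapping.lookup (dm F i r c) 0 = 0) \<and>
     {p. (\<lambda>r. if r = 0 then p else 0) \<in>
          mat_app (dm F 1) 1 (rk F 1) ` free_mod n (rk F 1)} = I \<and>
     (\<forall>i\<ge>1. {v \<in> free_mod n (rk F i). mat_app (dm F i) (rk F (i - 1)) (rk F i) v = (\<lambda>_. 0)}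
             = mat_app (dm F (Suc i)) (rk F i) (rk F (Suc i)) ` free_mod n (rk F (Suc i))))"

text \<open>beta_{i,j}(R/I) = number of basis elements of degree j in the i-th module of a
  minimal graded free resolution of R/I (= dim_k Tor_i^R(R/I,k)_j).\<close>
definition betti :: "nat \<Rightarrow> ('k::comm_ring_1) mpoly set \<Rightarrow> nat \<Rightarrow> nat \<Rightarrow> nat" where
  "betti n I i j = (let F = (SOME F. min_graded_free_res n I F)
                    in card {c. c < rk F i \<and> sh F i c = j})"

end

theory Submission
  imports Defs
begin

text \<open>Write \<open>\<beta>\<^sub>i\<^sub>,\<^sub>i\<^sub>+\<^sub>1\<close> as the rank of the linear strand of a minimal resolution \<open>F\<close>. By minimality the
  differential on the strand has linear entries, and iterating it down to \<open>F\<^sub>1\<close> identifies the strand with the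
  Koszul cycles with coefficients in the quadratic part of the Stanley--Reisner ideal, independently of \<open>F\<close>.
  Such a cycle is supported on sets \<open>W\<close> of \<open>i + 1\<close> vertices, and on each \<open>W\<close> it amounts to a potential on \<open>W\<close>
  that is constant along edges, modulo constants. Hence \<open>\<beta>\<^sub>i\<^sub>,\<^sub>i\<^sub>+\<^sub>1 = 0\<close> iff all induced subgraphs on \<open>i + 1\<close>
  vertices are connected, and sets of more than \<open>n - k\<close> vertices are the complements of sets of fewer than \<open>k\<close>.

  Since \<open>betti\<close> chooses some minimal resolution, one has to be exhibited. A multigraded one is built
  degreewise by linear algebra.\<close>

subsection \<open>Monomials and coefficients\<close>

text \<open>The criterion is the lowest case of Hochster's formula: beta_{i,i+1} adds up (number of
  components of the induced graph on W) - 1 over the vertex sets W of size i + 1. Only its vanishing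
  matters, so no dimension is computed: each direction transports a single nonzero object. The
  obstacle is that the choice in \<open>betti\<close> leaves the resolution F arbitrary and graded
  by total degree only; the multigrading belongs to the existence proof alone. The strand must
  therefore be read off from exactness and minimality of F. It sits in the lowest possible degree,
  hence the differential is linear on it; D o D = 0 makes its coefficient maps anticommute;
  minimality makes them jointly injective; exactness supplies preimages, whose constant parts
  already suffice. Characteristic zero is used where something equal to its own negative must
  vanish.\<close>

definition mon_le :: "(nat \<Rightarrow>\<^sub>0 nat) \<Rightarrow> (nat \<Rightarrow>\<^sub>0 nat) \<Rightarrow> bool" where
  "mon_le a b \<longleftrightarrow> (\<forall>i. Poly_Mapping.lookup a i \<le> Poly_Mapping.lookup b i)"

lemma mon_le_refl [simp]: "mon_le a a"
  by (simp add: mon_le_def)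

lemma mon_le_trans: "mon_le a b \<Longrightarrow> mon_le b c \<Longrightarrow> mon_le a c"
  unfolding mon_le_def using le_trans by blast

lemma mon_le_antisym: "mon_le a b \<Longrightarrow> mon_le b a \<Longrightarrow> a = b"
  by (rule poly_mapping_eqI) (simp add: mon_le_def antisym)

lemma mon_le_zero [simp]: "mon_le 0 a"
  by (simp add: mon_le_def)

lemma mon_le_add [simp]: "mon_le a (a + b)" "mon_le b (a + b)"
  by (simp_all add: mon_le_def lookup_add)

lemma mon_le_add_diff: "mon_le a b \<Longrightarrow> a + (b - a) = b"
  by (rule poly_mapping_eqI) (simp add: mon_le_def lookup_add lookup_minus)

lemma mon_le_diff_add: "mon_le a b \<Longrightarrow> b - a + a = b"
  by (metis add.commute mon_le_add_diff)

lemma mon_le_keys: "mon_le a b \<Longrightarrow> Poly_Mapping.keys a \<subseteq> Poly_Mapping.keys b"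
  by (metis in_keys_iff le_zero_eq mon_le_def subsetI)

lemma keys_add_mon: "Poly_Mapping.keys (a + b :: nat \<Rightarrow>\<^sub>0 nat) = Poly_Mapping.keys a \<union> Poly_Mapping.keys b"
  by (auto simp: in_keys_iff lookup_add)

lemma keys_diff_mon: "Poly_Mapping.keys (a - b :: nat \<Rightarrow>\<^sub>0 nat) \<subseteq> Poly_Mapping.keys a"
  by (auto simp: in_keys_iff lookup_minus)

lemma mon_deg_superset:
  assumes "finite S" "Poly_Mapping.keys m \<subseteq> S"
  shows "mon_deg m = (\<Sum>i\<in>S. Poly_Mapping.lookup m i)"
  unfolding mon_deg_def by (rule sum.mono_neutral_left) (use assms in \<open>auto simp: in_keys_iff\<close>)

lemma mon_deg_add: "mon_deg (a + b) = mon_deg a + mon_deg b"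
proof -
  let ?S = "Poly_Mapping.keys a \<union> Poly_Mapping.keys b"
  have "mon_deg (a + b) = (\<Sum>i\<in>?S. Poly_Mapping.lookup (a + b) i)"
    by (rule mon_deg_superset) (auto simp: keys_add_mon)
  also have "\<dots> = mon_deg a + mon_deg b"
    by (simp add: lookup_add sum.distrib mon_deg_superset[of ?S])
  finally show ?thesis .
qed

lemma mon_deg_zero [simp]: "mon_deg 0 = 0"
  by (simp add: mon_deg_def)

lemma mon_deg_single [simp]: "mon_deg (Poly_Mapping.single i k) = k"
  by (simp add: mon_deg_def)

lemma mon_deg_eq_0_iff [simp]: "mon_deg m = 0 \<longleftrightarrow> m = 0"
proof
  assume "mon_deg m = 0"
  then have "\<forall>i. Poly_Mapping.lookup m i = 0"
    by (metis finite_keys in_keys_iff mon_deg_def sum_eq_0_iff)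
  then show "m = 0" by (intro poly_mapping_eqI) simp
qed simp

text \<open>Truncated subtraction turns \<open>b + (a - b)\<close> into the least common multiple.\<close>

lemma mon_lcm:
  assumes "finite S"
  obtains j where "\<And>a. a \<in> S \<Longrightarrow> mon_le a j" "\<And>m. (\<And>a. a \<in> S \<Longrightarrow> mon_le a m) \<Longrightarrow> mon_le j m"
    "Poly_Mapping.keys j \<subseteq> (\<Union>a\<in>S. Poly_Mapping.keys a)"
proof -
  have "\<exists>j. (\<forall>a\<in>S. mon_le a j) \<and> (\<forall>m. (\<forall>a\<in>S. mon_le a m) \<longrightarrow> mon_le j m)
      \<and> Poly_Mapping.keys j \<subseteq> (\<Union>a\<in>S. Poly_Mapping.keys a)"
    using assms
  proof induction
    case empty
    then show ?case by (intro exI[of _ 0]) simp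
  next
    case (insert b S)
    then obtain j where j: "\<forall>a\<in>S. mon_le a j" "\<forall>m. (\<forall>a\<in>S. mon_le a m) \<longrightarrow> mon_le j m"
      "Poly_Mapping.keys j \<subseteq> (\<Union>a\<in>S. Poly_Mapping.keys a)" by blast
    have up: "mon_le j (b + (j - b))"
      by (simp add: mon_le_def lookup_add lookup_minus) arith
    have least: "mon_le (b + (j - b)) m" if "mon_le b m" "mon_le j m" for m
      unfolding mon_le_def lookup_add lookup_minus
    proof
      fix i
      show "Poly_Mapping.lookup b i + (Poly_Mapping.lookup j i - Poly_Mapping.lookup b i)
          \<le> Poly_Mapping.lookup m i"
        using that[unfolded mon_le_def, rule_format, of i] by arith
    qed
    have supp: "Poly_Mapping.keys (b + (j - b)) \<subseteq> (\<Union>a\<in>insert b S. Poly_Mapping.keys a)"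
      using j(3) keys_diff_mon[of j b] by (auto simp: keys_add_mon)
    show ?case
    proof (intro exI conjI ballI allI impI)
      show "mon_le a (b + (j - b))" if "a \<in> insert b S" for a
        using that j(1) mon_le_trans[OF _ up] by (cases "a = b") auto
      show "mon_le (b + (j - b)) m" if "\<forall>a\<in>insert b S. mon_le a m" for m
        using least[of m] j(2) that by blast
    qed (rule supp)
  qed
  then show ?thesis using that by blast
qed

lemma lookup_single_times:
  "Poly_Mapping.lookup (Poly_Mapping.single t l * p) m =
    (if mon_le t m then (l::'k::comm_ring_1) * Poly_Mapping.lookup p (m - t) else 0)"
proof -
  have eq: "(m = t + q) = (mon_le t m \<and> q = m - t)" for q
    by (auto simp: mon_le_add_diff)
  have "Poly_Mapping.lookup (Poly_Mapping.single t l * p) m =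
      (\<Sum>k. (l when t = k) * (\<Sum>q. Poly_Mapping.lookup p q when m = k + q))"
    by (simp add: lookup_mult lookup_single)
  also have "\<dots> = l * (\<Sum>q. Poly_Mapping.lookup p q when m = t + q)"
    by (simp add: when_mult)
  also have "(\<Sum>q. Poly_Mapping.lookup p q when m = t + q) =
      (Poly_Mapping.lookup p (m - t) when mon_le t m)"
    unfolding eq by (cases "mon_le t m") simp_all
  finally show ?thesis by (simp add: when_def)
qed

lemma poly_mapping_sum_single:
  "(\<Sum>m\<in>Poly_Mapping.keys p. Poly_Mapping.single m (Poly_Mapping.lookup p m)) = p"
proof (rule poly_mapping_eqI)
  fix k
  have "Poly_Mapping.lookup (\<Sum>m\<in>Poly_Mapping.keys p. Poly_Mapping.single m (Poly_Mapping.lookup p m)) k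
     = (\<Sum>m\<in>Poly_Mapping.keys p. if m = k then Poly_Mapping.lookup p k else 0)"
    unfolding lookup_sum lookup_single by (intro sum.cong) auto
  also have "\<dots> = Poly_Mapping.lookup p k"
    by (simp add: in_keys_iff)
  finally show "Poly_Mapping.lookup (\<Sum>m\<in>Poly_Mapping.keys p. Poly_Mapping.single m (Poly_Mapping.lookup p m)) k
     = Poly_Mapping.lookup p k" .
qed

lemma lookup_times_eq_0:
  assumes "\<And>a. Poly_Mapping.lookup p a \<noteq> 0 \<Longrightarrow> mon_le a m \<Longrightarrow> Poly_Mapping.lookup q (m - a) = 0"
  shows "Poly_Mapping.lookup (p * q) m = (0::'k::comm_ring_1)"
proof -
  have "p * q = (\<Sum>a\<in>Poly_Mapping.keys p. Poly_Mapping.single a (Poly_Mapping.lookup p a) * q)"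
    by (subst (1) poly_mapping_sum_single[of p, symmetric]) (simp add: sum_distrib_right)
  then show ?thesis
    using assms by (auto simp: lookup_sum lookup_single_times in_keys_iff intro!: sum.neutral)
qed

text \<open>The convolution at \<open>m\<close> runs over the divisors of \<open>m\<close> that
  occur in \<open>p\<close>, and only \<open>m\<close> itself is left. With \<open>p\<close> a
  matrix entry without terms of lower degree, this reads off the constant term of a
  preimage.\<close>

lemma lookup_times_leading:
  assumes "\<And>a. Poly_Mapping.lookup p a \<noteq> 0 \<Longrightarrow> mon_le a m \<Longrightarrow> a = m"
  shows "Poly_Mapping.lookup (p * q) m = Poly_Mapping.lookup p m * (Poly_Mapping.lookup q 0 :: 'k::comm_ring_1)"
proof -
  have "p * q = (\<Sum>a\<in>Poly_Mapping.keys p. Poly_Mapping.single a (Poly_Mapping.lookup p a) * q)"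
    by (subst (1) poly_mapping_sum_single[of p, symmetric]) (simp add: sum_distrib_right)
  then have "Poly_Mapping.lookup (p * q) m =
     (\<Sum>a\<in>Poly_Mapping.keys p. if a = m then Poly_Mapping.lookup p m * Poly_Mapping.lookup q 0 else 0)"
    using assms unfolding \<open>p * q = _\<close> lookup_sum lookup_single_times
    by (intro sum.cong) (auto simp: in_keys_iff)
  then show ?thesis by (simp add: in_keys_iff)
qed

lemma poly_ring_iff:
  "p \<in> poly_ring n \<longleftrightarrow> (\<forall>m. Poly_Mapping.lookup p m \<noteq> 0 \<longrightarrow> Poly_Mapping.keys m \<subseteq> {1..n})"
  by (auto simp: poly_ring_def in_keys_iff)

lemma poly_ring_zero [simp]: "0 \<in> poly_ring n"
  by (simp add: poly_ring_def)

lemma poly_ring_add: "p \<in> poly_ring n \<Longrightarrow> q \<in> poly_ring n \<Longrightarrow> p + q \<in> poly_ring n"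
  by (metis (no_types, lifting) add.right_neutral lookup_add poly_ring_iff)

lemma poly_ring_sum: "(\<And>i. i \<in> S \<Longrightarrow> f i \<in> poly_ring n) \<Longrightarrow> sum f S \<in> poly_ring n"
  by (induction S rule: infinite_finite_induct) (auto intro: poly_ring_add)

lemma poly_ring_single: "Poly_Mapping.keys m \<subseteq> {1..n} \<Longrightarrow> Poly_Mapping.single m c \<in> poly_ring n"
  by (simp add: poly_ring_def)

lemma poly_ring_mult: "p \<in> poly_ring n \<Longrightarrow> q \<in> poly_ring n \<Longrightarrow> p * q \<in> poly_ring n"
  using keys_mult[of p q] by (fastforce simp: poly_ring_def keys_add_mon)

subsection \<open>Monomial description of the Stanley--Reisner ideal\<close>

text \<open>Membership is tested on one monomial at a time, through its support alone, so every
  multigraded piece of the ideal is either zero or a line.\<close>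

definition nonface_ideal :: "nat \<Rightarrow> nat set set \<Rightarrow> ('k::comm_ring_1) mpoly set" where
  "nonface_ideal n \<Gamma> = {p \<in> poly_ring n. \<forall>m\<in>Poly_Mapping.keys p. Poly_Mapping.keys m \<notin> \<Gamma>}"

definition indicator_mon :: "nat set \<Rightarrow> (nat \<Rightarrow>\<^sub>0 nat)" where
  "indicator_mon S = (\<Sum>i\<in>S. Poly_Mapping.single i 1)"

lemma lookup_indicator_mon:
  "finite S \<Longrightarrow> Poly_Mapping.lookup (indicator_mon S) i = (if i \<in> S then 1 else 0)"
  by (simp add: indicator_mon_def lookup_sum lookup_single when_def)

lemma keys_indicator_mon: "finite S \<Longrightarrow> Poly_Mapping.keys (indicator_mon S) = S"
  by (auto simp: in_keys_iff lookup_indicator_mon split: if_splits)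

lemma indicator_mon_le: "mon_le (indicator_mon (Poly_Mapping.keys m)) m"
  by (auto simp: mon_le_def lookup_indicator_mon in_keys_iff)

text \<open>Multiplication only enlarges supports, and supersets of nonfaces are nonfaces;
  conversely a monomial with nonface support S is a multiple of the generator for S.\<close>

lemma SR_ideal_eq:
  assumes "\<And>S T. S \<in> \<Gamma> \<Longrightarrow> T \<subseteq> S \<Longrightarrow> T \<in> \<Gamma>"
  shows "(SR_ideal n \<Gamma> :: ('k::comm_ring_1) mpoly set) = nonface_ideal n \<Gamma>"
proof
  let ?gens = "{sqfree_monomial S | S. S \<subseteq> {1..n} \<and> S \<notin> \<Gamma>} :: 'k mpoly set"
  have "is_ideal_in n (nonface_ideal n \<Gamma> :: 'k mpoly set)"
    unfolding is_ideal_in_def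
  proof (intro conjI ballI)
    fix p q :: "'k mpoly" assume "p \<in> nonface_ideal n \<Gamma>" "q \<in> nonface_ideal n \<Gamma>"
    then show "p + q \<in> nonface_ideal n \<Gamma>"
      using keys_add[of p q] by (auto simp: nonface_ideal_def intro: poly_ring_add)
  next
    fix r p :: "'k mpoly" assume r: "r \<in> poly_ring n" and p: "p \<in> nonface_ideal n \<Gamma>"
    have "Poly_Mapping.keys m \<notin> \<Gamma>" if m: "m \<in> Poly_Mapping.keys (r * p)" for m
    proof -
      obtain a b where "m = a + b" "b \<in> Poly_Mapping.keys p"
        using m keys_mult[of r p] by auto
      then show ?thesis using p assms by (auto simp: nonface_ideal_def keys_add_mon)
    qed
    then show "r * p \<in> nonface_ideal n \<Gamma>"
      using r p by (simp add: nonface_ideal_def poly_ring_mult)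
  qed (auto simp: nonface_ideal_def)
  moreover have "?gens \<subseteq> nonface_ideal n \<Gamma>"
  proof
    fix p assume "p \<in> ?gens"
    then obtain S where S: "p = sqfree_monomial S" "S \<subseteq> {1..n}" "S \<notin> \<Gamma>" by blast
    then have "finite S" using finite_subset by blast
    then show "p \<in> nonface_ideal n \<Gamma>" using S keys_indicator_mon[of S]
      by (simp add: nonface_ideal_def poly_ring_def sqfree_monomial_def indicator_mon_def)
  qed
  ultimately show "SR_ideal n \<Gamma> \<subseteq> (nonface_ideal n \<Gamma> :: 'k mpoly set)"
    unfolding SR_ideal_def ideal_gen_def by blast
next
  show "nonface_ideal n \<Gamma> \<subseteq> (SR_ideal n \<Gamma> :: 'k mpoly set)"
    unfolding SR_ideal_def ideal_gen_def
  proof (intro subsetI InterI)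
    fix p :: "'k mpoly" and J assume p: "p \<in> nonface_ideal n \<Gamma>"
      and "J \<in> {J. is_ideal_in n J \<and> {sqfree_monomial S | S. S \<subseteq> {1..n} \<and> S \<notin> \<Gamma>} \<subseteq> (J :: 'k mpoly set)}"
    then have J: "is_ideal_in n J" and gen: "\<And>S. S \<subseteq> {1..n} \<Longrightarrow> S \<notin> \<Gamma> \<Longrightarrow> sqfree_monomial S \<in> J" by auto
    have "Poly_Mapping.single m c \<in> J" if m: "m \<in> Poly_Mapping.keys p" for m c
    proof -
      let ?S = "Poly_Mapping.keys m"
      have S: "?S \<subseteq> {1..n}" "?S \<notin> \<Gamma>" using p m by (auto simp: nonface_ideal_def poly_ring_def)
      have "Poly_Mapping.single (m - indicator_mon ?S) c * sqfree_monomial ?S \<in> J"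
        using J gen[OF S] S(1) keys_diff_mon[of m "indicator_mon ?S"]
        unfolding is_ideal_in_def by (metis order_trans poly_ring_single)
      then show ?thesis
        unfolding sqfree_monomial_def indicator_mon_def[symmetric] mult_single
        by (simp add: mon_le_diff_add[OF indicator_mon_le])
    qed
    moreover have "sum f S \<in> J" if "\<And>i. i \<in> S \<Longrightarrow> f i \<in> J" for f and S :: "(nat \<Rightarrow>\<^sub>0 nat) set"
      using that J by (induction S rule: infinite_finite_induct) (auto simp: is_ideal_in_def)
    ultimately show "p \<in> J" by (metis poly_mapping_sum_single)
  qed
qed

subsection \<open>Existence of a minimal multigraded resolution\<close>

text \<open>Induction on the number of coordinates: if some vector is nonzero at the last
  coordinate, subtracting multiples of it moves all others into the subspace where that coordinate
  vanishes, so one extra generator is enough.\<close>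

lemma finite_span_of_bounded_support:
  fixes K :: "(nat \<Rightarrow> 'k::field) set"
  assumes "\<And>x y. x \<in> K \<Longrightarrow> y \<in> K \<Longrightarrow> (\<lambda>i. x i + y i) \<in> K"
    and "\<And>c x. x \<in> K \<Longrightarrow> (\<lambda>i. c * x i) \<in> K"
    and "\<And>x i. x \<in> K \<Longrightarrow> i \<ge> b \<Longrightarrow> x i = 0"
  shows "\<exists>G. finite G \<and> G \<subseteq> K \<and> (\<forall>y\<in>K. \<exists>z. \<forall>r. y r = (\<Sum>g\<in>G. z g * g r))"
  using assms
proof (induction b arbitrary: K)
  case 0
  then show ?case by (intro exI[of _ "{}"]) simp
next
  case (Suc b)
  define K' where "K' = {x \<in> K. x b = 0}"
  have "\<exists>G. finite G \<and> G \<subseteq> K' \<and> (\<forall>y\<in>K'. \<exists>z. \<forall>r. y r = (\<Sum>g\<in>G. z g * g r))"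
  proof (rule Suc.IH)
    show "x i = 0" if "x \<in> K'" "i \<ge> b" for x i
      using that Suc.prems(3)[of x i] by (cases "i = b") (auto simp: K'_def)
  qed (use Suc.prems(1,2) in \<open>auto simp: K'_def\<close>)
  then obtain G where G: "finite G" "G \<subseteq> K'" "\<And>y. y \<in> K' \<Longrightarrow> \<exists>z. \<forall>r. y r = (\<Sum>g\<in>G. z g * g r)"
    by blast
  show ?case
  proof (cases "K' = K")
    case True
    then show ?thesis using G by blast
  next
    case False
    then obtain x where x: "x \<in> K" "x b \<noteq> 0" by (auto simp: K'_def)
    then have xG: "x \<notin> G" using G(2) by (auto simp: K'_def)
    have "\<exists>z. \<forall>r. y r = (\<Sum>g\<in>insert x G. z g * g r)" if y: "y \<in> K" for y
    proof -
      define c where "c = y b / x b"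
      have "(\<lambda>i. y i + (- c) * x i) \<in> K" using Suc.prems(1,2) x(1) y by blast
      then have "(\<lambda>i. y i + (- c) * x i) \<in> K'" using x(2) by (simp add: K'_def c_def)
      then obtain z where z: "\<And>r. y r + (- c) * x r = (\<Sum>g\<in>G. z g * g r)" using G(3) by blast
      have "(\<Sum>g\<in>G. (z(x := c)) g * g r) = (\<Sum>g\<in>G. z g * g r)" for r
        by (rule sum.cong) (use xG in auto)
      then have "y r = (\<Sum>g\<in>insert x G. (z(x := c)) g * g r)" for r
        using z[of r] G(1) xG by (simp add: algebra_simps)
      then show ?thesis by blast
    qed
    then show ?thesis using G x(1) by (intro exI[of _ "insert x G"]) (auto simp: K'_def)
  qed
qed

text \<open>Since all components of a multigraded free module are identified with subspaces of one
  coordinate space, a multigraded submodule is a monotone family \<open>K\<close> of subspaces; it is finitely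
  generated once every member already occurs at one of finitely many degrees \<open>D\<close>. A generating system
  of least cardinality has no relation with a unit coefficient.\<close>

lemma minimal_multigraded_generators:
  fixes K :: "(nat \<Rightarrow>\<^sub>0 nat) \<Rightarrow> (nat \<Rightarrow> 'k::field) set"
  assumes add: "\<And>m x y. x \<in> K m \<Longrightarrow> y \<in> K m \<Longrightarrow> (\<lambda>i. x i + y i) \<in> K m"
    and scale: "\<And>m c x. x \<in> K m \<Longrightarrow> (\<lambda>i. c * x i) \<in> K m"
    and bound: "\<And>m x i. x \<in> K m \<Longrightarrow> i \<ge> b \<Longrightarrow> x i = 0"
    and D: "finite D" "\<And>m y. y \<in> K m \<Longrightarrow> \<exists>d\<in>D. mon_le d m \<and> y \<in> K d"
  obtains b' :: nat and a' lam where
    "\<And>j. j < b' \<Longrightarrow> (\<lambda>r. lam r j) \<in> K (a' j)" "\<And>j. j < b' \<Longrightarrow> a' j \<in> D"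
    "\<And>m y. y \<in> K m \<Longrightarrow> \<exists>z. (\<forall>j. z j \<noteq> 0 \<longrightarrow> j < b' \<and> mon_le (a' j) m)
        \<and> (\<forall>r. y r = (\<Sum>j<b'. lam r j * z j))"
    "\<And>m z j. (\<And>j. z j \<noteq> 0 \<Longrightarrow> j < b' \<and> mon_le (a' j) m) \<Longrightarrow>
        (\<And>r. (\<Sum>j<b'. lam r j * z j) = 0) \<Longrightarrow> a' j = m \<Longrightarrow> z j = 0"
proof -
  define gens where "gens G \<longleftrightarrow> finite G \<and> (\<forall>p\<in>G. snd p \<in> K (fst p) \<and> fst p \<in> D) \<and>
    (\<forall>m. \<forall>y\<in>K m. \<exists>z. (\<forall>p\<in>G. z p \<noteq> 0 \<longrightarrow> mon_le (fst p) m) \<and> (\<forall>r. y r = (\<Sum>p\<in>G. snd p r * z p)))"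
    for G :: "((nat \<Rightarrow>\<^sub>0 nat) \<times> (nat \<Rightarrow> 'k)) set"
  have "\<exists>G. finite G \<and> G \<subseteq> K d \<and> (\<forall>y\<in>K d. \<exists>z. \<forall>r. y r = (\<Sum>g\<in>G. z g * g r))" for d
    by (rule finite_span_of_bounded_support[of _ b]) (use add scale bound in auto)
  then obtain H where H: "\<And>d. finite (H d)" "\<And>d. H d \<subseteq> K d"
    "\<And>d y. y \<in> K d \<Longrightarrow> \<exists>z. \<forall>r. y r = (\<Sum>g\<in>H d. z g * g r)" by metis
  \<comment> \<open>A generator is a vector tagged with the degree at which it is used; the same
    vector may occur at several degrees.\<close>
  have "gens (Sigma D H)"
    unfolding gens_def
  proof (intro conjI allI ballI)
    show "finite (Sigma D H)" using D(1) H(1) by blast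
    fix m y assume "y \<in> K m"
    then obtain d where d: "d \<in> D" "mon_le d m" "y \<in> K d" using D(2) by blast
    then obtain z where z: "\<And>r. y r = (\<Sum>g\<in>H d. z g * g r)" using H(3) by blast
    let ?z = "\<lambda>p. if fst p = d then z (snd p) else 0"
    have "y r = (\<Sum>p\<in>Sigma D H. snd p r * ?z p)" for r
    proof -
      have "(\<Sum>p\<in>Sigma D H. snd p r * ?z p) = (\<Sum>e\<in>D. \<Sum>g\<in>H e. g r * ?z (e, g))"
        by (subst sum.Sigma) (use D(1) H(1) in \<open>auto simp: split_def intro!: sum.cong\<close>)
      also have "\<dots> = (\<Sum>e\<in>D. if e = d then (\<Sum>g\<in>H d. z g * g r) else 0)"
        by (intro sum.cong) (auto simp: mult.commute)
      also have "\<dots> = y r" using d D(1) z by simp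
      finally show ?thesis ..
    qed
    then show "\<exists>z. (\<forall>p\<in>Sigma D H. z p \<noteq> 0 \<longrightarrow> mon_le (fst p) m) \<and>
        (\<forall>r. y r = (\<Sum>p\<in>Sigma D H. snd p r * z p))"
      using d by (intro exI[of _ ?z]) auto
  qed (use H(2) in \<open>auto simp: subset_iff\<close>)
  then obtain G where G: "gens G" and least: "\<And>G'. gens G' \<Longrightarrow> card G \<le> card G'"
    using ex_has_least_nat[of gens _ card] by blast
  then have fin: "finite G" by (simp add: gens_def)
  have spans: "\<exists>z. (\<forall>p\<in>G. z p \<noteq> 0 \<longrightarrow> mon_le (fst p) m) \<and> (\<forall>r. y r = (\<Sum>p\<in>G. snd p r * z p))"
    if "y \<in> K m" for y m
    using G that by (simp add: gens_def)
  have minimal: "z p = 0" if z: "\<And>p. p \<in> G \<Longrightarrow> z p \<noteq> 0 \<Longrightarrow> mon_le (fst p) m"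
      "\<And>r. (\<Sum>p\<in>G. snd p r * z p) = 0" and p: "p \<in> G" "fst p = m" for z m p
  proof (rule ccontr)
    assume nz: "z p \<noteq> 0"
    have p_eq: "snd p r * z p = - (\<Sum>q\<in>G - {p}. snd q r * z q)" for r
      using z(2)[of r] p(1) fin by (simp add: sum.remove[of G p] eq_neg_iff_add_eq_0)
    have "gens (G - {p})"
      unfolding gens_def
    proof (intro conjI allI ballI)
      fix m' y assume "y \<in> K m'"
      then obtain w where w: "\<And>p. p \<in> G \<Longrightarrow> w p \<noteq> 0 \<Longrightarrow> mon_le (fst p) m'"
        "\<And>r. y r = (\<Sum>p\<in>G. snd p r * w p)" using spans by meson
      \<comment> \<open>The relation \<open>z\<close> is used to eliminate \<open>p\<close>: the
        coefficient at \<open>p\<close> becomes 0. Degrees stay admissible, because a contribution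
        of \<open>z\<close> at \<open>q\<close> needs \<open>w p\<close> nonzero, and then
        \<open>fst q\<close> divides \<open>m = fst p\<close>, which divides
        \<open>m'\<close>.\<close>
      define w' where "w' q = w q - w p / z p * z q" for q
      have "y r = (\<Sum>q\<in>G - {p}. snd q r * w' q)" for r
      proof -
        have "y r = w p / z p * (snd p r * z p) + (\<Sum>q\<in>G - {p}. snd q r * w q)"
          using w(2)[of r] p(1) fin nz by (simp add: sum.remove[of G p])
        then show ?thesis
          unfolding p_eq w'_def by (simp add: sum_subtractf sum_distrib_left algebra_simps)
      qed
      moreover have "mon_le (fst q) m'" if "q \<in> G - {p}" "w' q \<noteq> 0" for q
      proof (cases "w q = 0")
        case True
        then have "w p \<noteq> 0" "z q \<noteq> 0" using that by (auto simp: w'_def)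
        then show ?thesis using w(1)[OF p(1)] z(1)[of q] that(1) p(2) mon_le_trans by blast
      qed (use w(1) that in blast)
      ultimately show "\<exists>z. (\<forall>q\<in>G - {p}. z q \<noteq> 0 \<longrightarrow> mon_le (fst q) m') \<and>
        (\<forall>r. y r = (\<Sum>q\<in>G - {p}. snd q r * z q))" by blast
    qed (use G in \<open>simp_all add: gens_def\<close>)
    then have "card G \<le> card (G - {p})" by (rule least)
    then show False using p(1) fin by (metis card_Diff1_less not_less)
  qed
  obtain h where h: "bij_betw h {..<card G} G"
    using fin ex_bij_betw_nat_finite lessThan_atLeast0 by metis
  have reindex: "(\<Sum>p\<in>G. f p) = (\<Sum>j<card G. f (h j))" for f :: "_ \<Rightarrow> 'k"
    by (rule sum.reindex_bij_betw[OF h, symmetric])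
  have hG: "j < card G \<Longrightarrow> h j \<in> G" for j using h by (auto simp: bij_betw_def)
  define g where "g = inv_into {..<card G} h"
  have gh: "j < card G \<Longrightarrow> g (h j) = j" for j
    using h by (simp add: g_def bij_betw_def)
  have hg: "p \<in> G \<Longrightarrow> g p < card G \<and> h (g p) = p" for p
    using h by (metis bij_betw_def bij_betw_inv_into_right g_def inv_into_into lessThan_iff)
  show ?thesis
  proof (rule that[of "card G" "\<lambda>r j. snd (h j) r" "\<lambda>j. fst (h j)"])
    show "(\<lambda>r. snd (h j) r) \<in> K (fst (h j))" "fst (h j) \<in> D" if "j < card G" for j
      using G hG[OF that] by (auto simp: gens_def)
    fix m y assume "y \<in> K m"
    then obtain z where z: "\<And>p. p \<in> G \<Longrightarrow> z p \<noteq> 0 \<Longrightarrow> mon_le (fst p) m"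
        "\<And>r. y r = (\<Sum>p\<in>G. snd p r * z p)" using spans by meson
    let ?z = "\<lambda>j. if j < card G then z (h j) else 0"
    show "\<exists>z. (\<forall>j. z j \<noteq> 0 \<longrightarrow> j < card G \<and> mon_le (fst (h j)) m) \<and>
        (\<forall>r. y r = (\<Sum>j<card G. snd (h j) r * z j))"
      by (rule exI[of _ ?z]) (use z hG in \<open>auto simp: reindex\<close>)
  next
    fix m z j assume z: "\<And>j. z j \<noteq> 0 \<Longrightarrow> j < card G \<and> mon_le (fst (h j)) m"
        "\<And>r. (\<Sum>j<card G. snd (h j) r * z j) = 0" "fst (h j) = m"
    show "z j = 0"
    proof (cases "j < card G")
      case True
      have "z (g (h j)) = 0"
      proof (rule minimal)
        show "mon_le (fst p) m" if "p \<in> G" "z (g p) \<noteq> 0" for p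
          using z(1)[OF that(2)] hg[OF that(1)] by simp
        show "(\<Sum>p\<in>G. snd p r * z (g p)) = 0" for r
          using z(2)[of r] by (simp add: reindex gh)
      qed (use hG True z(3) in auto)
      then show ?thesis using gh True by simp
    qed (use z(1) in blast)
  qed
qed

section \<open>Stages of the resolution in a fixed multidegree\<close>

text \<open>In multidegree \<open>m\<close> the basis vector c, of degree \<open>a c\<close>,
  contributes just the monomial \<open>m - a c\<close>, provided that \<open>a c\<close> divides
  \<open>m\<close>. Recording only its coefficient turns a multigraded map into the scalar matrix
  \<open>lam\<close> acting on the admissible coordinates; \<open>ker_at\<close> and
  \<open>img_at\<close> are the kernel and image in that degree.\<close>

definition ker_at :: "nat \<Rightarrow> nat \<Rightarrow> (nat \<Rightarrow> nat \<Rightarrow>\<^sub>0 nat) \<Rightarrow> (nat \<Rightarrow> nat \<Rightarrow> 'k::field)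
    \<Rightarrow> (nat \<Rightarrow>\<^sub>0 nat) \<Rightarrow> (nat \<Rightarrow> 'k) set" where
  "ker_at b0 b a lam m = {y. (\<forall>c. y c \<noteq> 0 \<longrightarrow> c < b \<and> mon_le (a c) m) \<and>
      (\<forall>r<b0. (\<Sum>c<b. lam r c * y c) = 0)}"

definition img_at :: "nat \<Rightarrow> (nat \<Rightarrow> nat \<Rightarrow>\<^sub>0 nat) \<Rightarrow> (nat \<Rightarrow> nat \<Rightarrow> 'k::field)
    \<Rightarrow> (nat \<Rightarrow>\<^sub>0 nat) \<Rightarrow> (nat \<Rightarrow> 'k) set" where
  "img_at b a lam m = {y. \<exists>z. (\<forall>j. z j \<noteq> 0 \<longrightarrow> j < b \<and> mon_le (a j) m) \<and>
      (\<forall>r. y r = (\<Sum>j<b. lam r j * z j))}"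

text \<open>The last clause is minimality: in degree \<open>a c\<close> the coordinate c of a syzygy
  is a constant coefficient, and no syzygy may have a nonzero one.\<close>

definition reduced_stage :: "nat \<Rightarrow> nat \<Rightarrow> nat \<Rightarrow> (nat \<Rightarrow> nat \<Rightarrow>\<^sub>0 nat) \<Rightarrow> (nat \<Rightarrow> nat \<Rightarrow> 'k::field) \<Rightarrow> bool" where
  "reduced_stage n b0 b a lam \<longleftrightarrow> (\<forall>c<b. Poly_Mapping.keys (a c) \<subseteq> {1..n}) \<and>
     (\<forall>c y. y \<in> ker_at b0 b a lam (a c) \<longrightarrow> y c = 0)"

lemma reduced_generators:
  fixes K :: "(nat \<Rightarrow>\<^sub>0 nat) \<Rightarrow> (nat \<Rightarrow> 'k::field) set"
  assumes add: "\<And>m x y. x \<in> K m \<Longrightarrow> y \<in> K m \<Longrightarrow> (\<lambda>i. x i + y i) \<in> K m"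
    and scale: "\<And>m c x. x \<in> K m \<Longrightarrow> (\<lambda>i. c * x i) \<in> K m"
    and zero: "\<And>m. (\<lambda>_. 0) \<in> K m"
    and mono: "\<And>m m' x. x \<in> K m \<Longrightarrow> mon_le m m' \<Longrightarrow> x \<in> K m'"
    and bound: "\<And>m x i. x \<in> K m \<Longrightarrow> i \<ge> b \<Longrightarrow> x i = 0"
    and D: "finite D" "\<And>m y. y \<in> K m \<Longrightarrow> \<exists>d\<in>D. mon_le d m \<and> y \<in> K d"
    and keysD: "\<And>d. d \<in> D \<Longrightarrow> Poly_Mapping.keys d \<subseteq> {1..n}"
  shows "\<exists>b' a' lam. reduced_stage n b b' a' lam \<and> (\<forall>j<b'. (\<lambda>r. lam r j) \<in> K (a' j)) \<and>
    (\<forall>m. K m = img_at b' a' lam m)"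
proof (rule minimal_multigraded_generators[of K b D])
  fix b' :: nat and a' lam
  assume
    col: "\<And>j. j < b' \<Longrightarrow> (\<lambda>r. lam r j) \<in> K (a' j)" and D': "\<And>j. j < b' \<Longrightarrow> a' j \<in> D" and
    span: "\<And>m y. y \<in> K m \<Longrightarrow> \<exists>z. (\<forall>j. z j \<noteq> 0 \<longrightarrow> j < b' \<and> mon_le (a' j) m)
        \<and> (\<forall>r. y r = (\<Sum>j<b'. lam r j * z j))" and
    minimal: "\<And>m z j. (\<And>j. z j \<noteq> 0 \<Longrightarrow> j < b' \<and> mon_le (a' j) m) \<Longrightarrow>
        (\<And>r. (\<Sum>j<b'. lam r j * z j) = 0) \<Longrightarrow> a' j = m \<Longrightarrow> z j = 0"
  have "reduced_stage n b b' a' lam"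
    unfolding reduced_stage_def
  proof (intro conjI allI impI)
    fix c y assume y: "y \<in> ker_at b b' a' lam (a' c)"
    show "y c = 0"
    proof (rule minimal[of y "a' c"])
      \<comment> \<open>\<open>ker_at\<close> tests only the rows below \<open>b\<close>; the
        columns lie in \<open>K\<close>, so they vanish in all other rows.\<close>
      show "(\<Sum>j<b'. lam r j * y j) = 0" for r
      proof (cases "r < b")
        case False
        then have "lam r j = 0" if "j < b'" for j using bound[OF col[OF that], of r] by simp
        then show ?thesis by simp
      qed (use y in \<open>simp add: ker_at_def\<close>)
      show "j < b' \<and> mon_le (a' j) (a' c)" if "y j \<noteq> 0" for j
        using y that unfolding ker_at_def by blast
    qed (rule refl)
  next
    show "Poly_Mapping.keys (a' c) \<subseteq> {1..n}" if "c < b'" for c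
      by (rule keysD[OF D'[OF that]])
  qed
  moreover have "K m = img_at b' a' lam m" for m
  proof
    show "K m \<subseteq> img_at b' a' lam m" using span by (auto simp: img_at_def)
    show "img_at b' a' lam m \<subseteq> K m"
    proof
      fix y assume "y \<in> img_at b' a' lam m"
      then obtain z where z: "\<And>j. z j \<noteq> 0 \<Longrightarrow> j < b' \<and> mon_le (a' j) m"
        "\<And>r. y r = (\<Sum>j<b'. lam r j * z j)" by (auto simp: img_at_def)
      have "(\<lambda>r. \<Sum>j<k. lam r j * z j) \<in> K m" if "k \<le> b'" for k
        using that
      proof (induction k)
        case (Suc k)
        have "(\<lambda>r. z k * lam r k) \<in> K m"
        proof (cases "z k = 0")
          case False
          then show ?thesis using scale[OF mono[OF col]] z(1) Suc.prems by simp
        qed (simp add: zero)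
        then show ?case using add[OF Suc.IH, of "\<lambda>r. z k * lam r k"] Suc.prems
          by (simp add: mult.commute)
      qed (simp add: zero)
      moreover have "y = (\<lambda>r. \<Sum>j<b'. lam r j * z j)" using z(2) by blast
      ultimately show "y \<in> K m" by blast
    qed
  qed
  ultimately show ?thesis using col by blast
qed (fact add scale bound D)+

text \<open>The kernel at degree \<open>m\<close> depends only on \<open>{c. a c | m}\<close>, hence agrees with the kernel at the least
  common multiple of those monomials: only finitely many degrees carry generators of the syzygies.\<close>

lemma next_stage:
  assumes "\<forall>c<b. Poly_Mapping.keys (a c) \<subseteq> {1..n}"
  shows "\<exists>b' a' lam'. reduced_stage n b b' a' lam' \<and>
    (\<forall>j<b'. (\<lambda>r. lam' r j) \<in> ker_at b0 b a lam (a' j)) \<and>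
    (\<forall>m. ker_at b0 b a lam m = img_at b' a' lam' m)"
proof -
  have "\<exists>j. (\<forall>c\<in>S. mon_le (a c) j) \<and> (\<forall>m. (\<forall>c\<in>S. mon_le (a c) m) \<longrightarrow> mon_le j m) \<and>
      Poly_Mapping.keys j \<subseteq> (\<Union>c\<in>S. Poly_Mapping.keys (a c))" if "finite S" for S
    by (rule mon_lcm[OF finite_imageI[OF that], of a]) blast
  then obtain l where l: "\<And>S c. finite S \<Longrightarrow> c \<in> S \<Longrightarrow> mon_le (a c) (l S)"
    "\<And>S m. finite S \<Longrightarrow> (\<And>c. c \<in> S \<Longrightarrow> mon_le (a c) m) \<Longrightarrow> mon_le (l S) m"
    "\<And>S. finite S \<Longrightarrow> Poly_Mapping.keys (l S) \<subseteq> (\<Union>c\<in>S. Poly_Mapping.keys (a c))" by metis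
  show ?thesis
  proof (rule reduced_generators[of _ b "l ` Pow {..<b}" n])
    fix m x assume x: "x \<in> ker_at b0 b a lam m"
    let ?S = "{c. c < b \<and> mon_le (a c) m}"
    show "\<exists>d\<in>l ` Pow {..<b}. mon_le d m \<and> x \<in> ker_at b0 b a lam d"
    proof (rule bexI[of _ "l ?S"], rule conjI)
      show "mon_le (l ?S) m" by (rule l(2)) auto
      show "x \<in> ker_at b0 b a lam (l ?S)"
        using x l(1)[of ?S] by (auto simp: ker_at_def)
    qed auto
    show "(\<lambda>i. c * x i) \<in> ker_at b0 b a lam m" for c
    proof -
      have "(\<Sum>i<b. lam r i * (c * x i)) = c * (\<Sum>i<b. lam r i * x i)" for r
        by (simp add: sum_distrib_left mult.left_commute)
      then show ?thesis using x by (simp add: ker_at_def)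
    qed
    show "x i = 0" if "b \<le> i" for i
      using x that by (auto simp: ker_at_def)
    show "x \<in> ker_at b0 b a lam m'" if "mon_le m m'" for m'
      using x mon_le_trans[OF _ that] by (auto simp: ker_at_def)
    fix y assume y: "y \<in> ker_at b0 b a lam m"
    have "c < b \<and> mon_le (a c) m" if "x c + y c \<noteq> 0" for c
      using x y that by (cases "x c = 0") (auto simp: ker_at_def)
    then show "(\<lambda>i. x i + y i) \<in> ker_at b0 b a lam m"
      using x y by (simp add: ker_at_def distrib_left sum.distrib)
  next
    fix d assume "d \<in> l ` Pow {..<b}"
    then obtain S where "S \<subseteq> {..<b}" "d = l S" by blast
    then show "Poly_Mapping.keys d \<subseteq> {1..n}"
      using l(3)[OF finite_subset[OF _ finite_lessThan], of S b] assms by blast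
  qed (simp_all add: ker_at_def)
qed

text \<open>The ideal as a submodule of the rank one module R, in the same componentwise form as the
  kernels. Intersecting with \<open>{1..n}\<close> makes foreign variables harmless: otherwise each
  of them could demand a generator of its own.\<close>

definition nonface_at :: "nat \<Rightarrow> nat set set \<Rightarrow> (nat \<Rightarrow>\<^sub>0 nat) \<Rightarrow> (nat \<Rightarrow> 'k::field) set" where
  "nonface_at n \<Gamma> m = {y. \<forall>c. y c \<noteq> 0 \<longrightarrow> c = 0 \<and> Poly_Mapping.keys m \<inter> {1..n} \<notin> \<Gamma>}"

text \<open>Whether the component at \<open>m\<close> is nonzero depends only on the support of
  \<open>m\<close> inside \<open>{1..n}\<close>, so the squarefree monomials are the only degrees to
  be searched for generators.\<close>

lemma first_stage:
  assumes \<Gamma>: "\<And>S T. S \<in> \<Gamma> \<Longrightarrow> T \<subseteq> S \<Longrightarrow> T \<in> \<Gamma>"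
  shows "\<exists>b' a' lam'. reduced_stage n 1 b' a' (lam' :: nat \<Rightarrow> nat \<Rightarrow> 'k::field) \<and>
    (\<forall>j<b'. (\<lambda>r. lam' r j) \<in> nonface_at n \<Gamma> (a' j)) \<and>
    (\<forall>m. nonface_at n \<Gamma> m = img_at b' a' lam' m)"
proof (rule reduced_generators[of _ 1 "insert 0 (indicator_mon ` Pow {1..n})" n])
  fix m and x :: "nat \<Rightarrow> 'k" assume x: "x \<in> nonface_at n \<Gamma> m"
  show "(\<lambda>i. c * x i) \<in> nonface_at n \<Gamma> m" for c
    using x by (auto simp: nonface_at_def)
  show "x i = 0" if "1 \<le> i" for i
    using x that by (auto simp: nonface_at_def)
  show "(\<lambda>i. x i + y i) \<in> nonface_at n \<Gamma> m" if "y \<in> nonface_at n \<Gamma> m" for y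
    using x that by (auto simp: nonface_at_def) (metis add.right_neutral)+
  show "x \<in> nonface_at n \<Gamma> m'" if "mon_le m m'" for m'
    using x mon_le_keys[OF that] \<Gamma>[of "Poly_Mapping.keys m' \<inter> {1..n}" "Poly_Mapping.keys m \<inter> {1..n}"]
    by (auto simp: nonface_at_def)
  show "\<exists>d\<in>insert 0 (indicator_mon ` Pow {1..n}). mon_le d m \<and> x \<in> nonface_at n \<Gamma> d"
  proof (cases "x = (\<lambda>_. 0)")
    case True
    then show ?thesis by (intro bexI[of _ 0]) (auto simp: nonface_at_def)
  next
    case False
    let ?S = "Poly_Mapping.keys m \<inter> {1..n}"
    have "mon_le (indicator_mon ?S) m"
      by (auto simp: mon_le_def lookup_indicator_mon in_keys_iff)
    moreover have "x \<in> nonface_at n \<Gamma> (indicator_mon ?S)"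
      using x by (simp add: nonface_at_def keys_indicator_mon)
    ultimately show ?thesis by blast
  qed
next
  fix d assume "d \<in> insert 0 (indicator_mon ` Pow {1..n})"
  then consider "d = 0" | S where "S \<subseteq> {1..n}" "d = indicator_mon S" by blast
  then show "Poly_Mapping.keys d \<subseteq> {1..n}"
  proof cases
    case (2 S)
    then show ?thesis using keys_indicator_mon[OF finite_subset[of S "{1..n}"]] by simp
  qed simp
qed (auto simp: nonface_at_def)

lemma multigraded_resolution:
  assumes \<Gamma>: "\<And>S T. S \<in> \<Gamma> \<Longrightarrow> T \<subseteq> S \<Longrightarrow> T \<in> \<Gamma>" "{} \<in> \<Gamma>"
  obtains B :: "nat \<Rightarrow> nat" and A :: "nat \<Rightarrow> nat \<Rightarrow> nat \<Rightarrow>\<^sub>0 nat" and L :: "nat \<Rightarrow> nat \<Rightarrow> nat \<Rightarrow> 'k::field"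
  where "B 0 = 1" "A 0 = (\<lambda>_. 0)"
    "\<And>i c. c < B i \<Longrightarrow> Poly_Mapping.keys (A i c) \<subseteq> {1..n}"
    "\<And>i r c. c < B (Suc i) \<Longrightarrow> L i r c \<noteq> 0 \<Longrightarrow>
        r < B i \<and> mon_le (A i r) (A (Suc i) c) \<and> A i r \<noteq> A (Suc i) c"
    "\<And>m. nonface_at n \<Gamma> m = img_at (B 1) (A 1) (L 0) m"
    "\<And>i m. ker_at (B i) (B (Suc i)) (A (Suc i)) (L i) m = img_at (B (Suc (Suc i))) (A (Suc (Suc i))) (L (Suc i)) m"
proof -
  \<comment> \<open>A state describes one map: number of rows, number of columns, column degrees,
    scalar matrix. \<open>good\<close> is the invariant, and \<open>step\<close> says that the next
    map has the kernel of this one as its image.\<close>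
  define good where "good s \<longleftrightarrow> (case s of (b0, b, a, lam) \<Rightarrow> reduced_stage n b0 b a lam)"
    for s :: "nat \<times> nat \<times> (nat \<Rightarrow> nat \<Rightarrow>\<^sub>0 nat) \<times> (nat \<Rightarrow> nat \<Rightarrow> 'k)"
  define step where "step s s' \<longleftrightarrow> (case s of (b0, b, a, lam) \<Rightarrow> case s' of (b0', b', a', lam') \<Rightarrow>
      b0' = b \<and> (\<forall>j<b'. (\<lambda>r. lam' r j) \<in> ker_at b0 b a lam (a' j)) \<and>
      (\<forall>m. ker_at b0 b a lam m = img_at b' a' lam' m))"
    for s s' :: "nat \<times> nat \<times> (nat \<Rightarrow> nat \<Rightarrow>\<^sub>0 nat) \<times> (nat \<Rightarrow> nat \<Rightarrow> 'k)"
  obtain b1 a1 and l1 :: "nat \<Rightarrow> nat \<Rightarrow> 'k" where s1: "reduced_stage n 1 b1 a1 l1"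
    "\<And>j. j < b1 \<Longrightarrow> (\<lambda>r. l1 r j) \<in> nonface_at n \<Gamma> (a1 j)"
    "\<And>m. nonface_at n \<Gamma> m = img_at b1 a1 l1 m"
    using first_stage[of \<Gamma> n, where ?'k = 'k] \<Gamma>(1) by blast
  have "\<exists>f. f 0 = (1, b1, a1, l1) \<and> (\<forall>i. good (f i) \<and> step (f i) (f (Suc i)))"
  proof -
    have "\<exists>f. \<forall>i. (good (f i) \<and> (i = 0 \<longrightarrow> f i = (1, b1, a1, l1))) \<and> step (f i) (f (Suc i))"
    proof (rule dependent_nat_choice)
      show "\<exists>s. good s \<and> ((0::nat) = 0 \<longrightarrow> s = (1, b1, a1, l1))"
        using s1(1) by (auto simp: good_def)
      fix s and i :: nat assume "good s \<and> (i = 0 \<longrightarrow> s = (1, b1, a1, l1))"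
      moreover obtain b0 b a lam where s: "s = (b0, b, a, lam)" by (cases s)
      ultimately have "\<forall>c<b. Poly_Mapping.keys (a c) \<subseteq> {1..n}" by (simp add: good_def reduced_stage_def)
      from next_stage[OF this, of b0 lam] obtain b' a' lam' where
        "reduced_stage n b b' a' lam'"
        "\<forall>j<b'. (\<lambda>r. lam' r j) \<in> ker_at b0 b a lam (a' j)"
        "\<forall>m. ker_at b0 b a lam m = img_at b' a' lam' m" by blast
      then show "\<exists>s'. (good s' \<and> (Suc i = 0 \<longrightarrow> s' = (1, b1, a1, l1))) \<and> step s s'"
        by (intro exI[of _ "(b, b', a', lam')"]) (simp add: s good_def step_def)
    qed
    then show ?thesis by blast
  qed
  then obtain f where f: "f 0 = (1, b1, a1, l1)" "\<And>i. good (f i)" "\<And>i. step (f i) (f (Suc i))" by blast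
  \<comment> \<open>State \<open>f i\<close> is the map from module i + 1 to module i, so module 0,
    with one generator in degree 0, is supplied separately.\<close>
  define B where "B i = (case i of 0 \<Rightarrow> 1 | Suc j \<Rightarrow> fst (snd (f j)))" for i
  define A where "A i = (case i of 0 \<Rightarrow> (\<lambda>_. 0) | Suc j \<Rightarrow> fst (snd (snd (f j))))" for i
  define L where "L i = snd (snd (snd (f i)))" for i
  have fst_f: "fst (f i) = B i" for i
    using f(1) f(3)[of "i - 1"] by (cases i) (auto simp: B_def step_def split: prod.splits)
  then have f_eq: "f i = (B i, B (Suc i), A (Suc i), L i)" for i
    by (simp add: B_def A_def L_def prod_eq_iff)
  have red: "reduced_stage n (B i) (B (Suc i)) (A (Suc i)) (L i)" for i
    using f(2)[of i] by (simp add: f_eq good_def)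
  have col: "j < B (Suc (Suc i)) \<Longrightarrow> (\<lambda>r. L (Suc i) r j) \<in> ker_at (B i) (B (Suc i)) (A (Suc i)) (L i) (A (Suc (Suc i)) j)"
    and exact: "ker_at (B i) (B (Suc i)) (A (Suc i)) (L i) m = img_at (B (Suc (Suc i))) (A (Suc (Suc i))) (L (Suc i)) m"
    for i j m
    using f(3)[of i] by (auto simp: f_eq step_def)
  have init: "B 0 = 1" "A 0 = (\<lambda>_. 0)" "B 1 = b1" "A 1 = a1" "L 0 = l1"
    using f(1) by (simp_all add: B_def A_def L_def)
  show ?thesis
  proof (rule that[of B A L, OF init(1,2)])
    show "Poly_Mapping.keys (A i c) \<subseteq> {1..n}" if "c < B i" for i c
      using that red[of "i - 1"] init(2) by (cases i) (auto simp: reduced_stage_def)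
    show "r < B i \<and> mon_le (A i r) (A (Suc i) c) \<and> A i r \<noteq> A (Suc i) c"
      if c: "c < B (Suc i)" and nz: "L i r c \<noteq> 0" for i r c
    proof (cases i)
      case 0
      have "r = 0 \<and> Poly_Mapping.keys (a1 c) \<inter> {1..n} \<notin> \<Gamma>"
        using s1(2)[of c] c nz init 0 by (auto simp: nonface_at_def)
      \<comment> \<open>The empty set is a face, so 1 is not in the ideal and the first map has no
        constant entry either.\<close>
      moreover from this have "a1 c \<noteq> 0" using \<Gamma>(2) by auto
      ultimately show ?thesis using init 0 by auto
    next
      case (Suc j)
      let ?y = "\<lambda>r. L (Suc j) r c"
      have y: "?y \<in> ker_at (B j) (B (Suc j)) (A (Suc j)) (L j) (A (Suc (Suc j)) c)"
        using col c Suc by simp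
      \<comment> \<open>Equal degrees would make this entry a constant coefficient of a syzygy,
        which \<open>reduced_stage\<close> forces to be zero.\<close>
      moreover have "A (Suc j) r \<noteq> A (Suc (Suc j)) c"
        using red[of j] y nz Suc unfolding reduced_stage_def by metis
      ultimately show ?thesis using nz Suc by (auto simp: ker_at_def)
    qed
    show "nonface_at n \<Gamma> m = img_at (B 1) (A 1) (L 0) m" for m
      unfolding init by (rule s1(3))
  qed (rule exact)
qed

section \<open>From multigraded components to modules over the polynomial ring\<close>

lemma free_mod_zero: "(\<lambda>_. 0) \<in> free_mod n b"
  by (simp add: free_mod_def)

lemma mat_app_free_mod:
  assumes "\<And>r c. r < a \<Longrightarrow> c < b \<Longrightarrow> M r c \<in> poly_ring n" "v \<in> free_mod n b"
  shows "mat_app M a b v \<in> free_mod n a"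
  using assms by (auto simp: free_mod_def mat_app_def intro!: poly_ring_sum poly_ring_mult)

text \<open>The coordinates of the multidegree \<open>m\<close> part of a vector of polynomials. The
  divisibility guard is essential, since \<open>m - a c\<close> is truncated.\<close>

definition comp_at :: "nat \<Rightarrow> (nat \<Rightarrow> nat \<Rightarrow>\<^sub>0 nat) \<Rightarrow> (nat \<Rightarrow> 'k::comm_ring_1 mpoly) \<Rightarrow> (nat \<Rightarrow>\<^sub>0 nat) \<Rightarrow> nat \<Rightarrow> 'k" where
  "comp_at b a v m = (\<lambda>c. if c < b \<and> mon_le (a c) m then Poly_Mapping.lookup (v c) (m - a c) else 0)"

definition mg_matrix :: "(nat \<Rightarrow> nat \<Rightarrow>\<^sub>0 nat) \<Rightarrow> (nat \<Rightarrow> nat \<Rightarrow>\<^sub>0 nat) \<Rightarrow> (nat \<Rightarrow> nat \<Rightarrow> 'k::comm_ring_1) \<Rightarrow> nat \<Rightarrow> nat \<Rightarrow> 'k mpoly" where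
  "mg_matrix a a' lam r c = Poly_Mapping.single (a' c - a r) (lam r c)"

lemma comp_at_inj:
  assumes "v \<in> free_mod n b" "w \<in> free_mod n b" "\<And>m. comp_at b a v m = comp_at b a w m"
  shows "v = w"
proof
  fix c
  show "v c = w c"
  proof (cases "c < b")
    case True
    show ?thesis
    proof (rule poly_mapping_eqI)
      fix t show "Poly_Mapping.lookup (v c) t = Poly_Mapping.lookup (w c) t"
        using fun_cong[OF assms(3)[of "t + a c"], of c] True by (simp add: comp_at_def)
    qed
  qed (use assms(1,2) in \<open>simp add: free_mod_def\<close>)
qed

text \<open>The monomial factor of an entry is exactly the difference of the two degrees, so it
  cancels against the shifts and only the scalar remains. This reduces exactness over R to exactness
  in each multidegree.\<close>

lemma comp_at_mat_app:
  assumes lam: "\<And>r c. c < b' \<Longrightarrow> lam r c \<noteq> 0 \<Longrightarrow> r < b \<and> mon_le (a r) (a' c)"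
  shows "comp_at b a (mat_app (mg_matrix a a' lam) b b' v) m = (\<lambda>r. \<Sum>c<b'. lam r c * comp_at b' a' v m c)"
proof
  fix r
  show "comp_at b a (mat_app (mg_matrix a a' lam) b b' v) m r = (\<Sum>c<b'. lam r c * comp_at b' a' v m c)"
  proof (cases "r < b \<and> mon_le (a r) m")
    case True
    have "Poly_Mapping.lookup (mg_matrix a a' lam r c * v c) (m - a r) = lam r c * comp_at b' a' v m c"
      if c: "c < b'" for c
    proof (cases "lam r c = 0")
      case False
      then have le: "mon_le (a r) (a' c)" using lam c by blast
      have "mon_le (a' c - a r) (m - a r) \<longleftrightarrow> mon_le (a' c) m"
      proof
        assume "mon_le (a' c - a r) (m - a r)"
        then have "mon_le (a' c - a r + a r) (m - a r + a r)"
          by (simp add: mon_le_def lookup_add)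
        then show "mon_le (a' c) m" using True le by (simp add: mon_le_diff_add)
      next
        assume "mon_le (a' c) m"
        then show "mon_le (a' c - a r) (m - a r)" by (simp add: mon_le_def lookup_minus diff_le_mono)
      qed
      moreover have "m - a r - (a' c - a r) = m - a' c"
      proof (rule poly_mapping_eqI)
        fix i
        show "Poly_Mapping.lookup (m - a r - (a' c - a r)) i = Poly_Mapping.lookup (m - a' c) i"
          using le[unfolded mon_le_def, rule_format, of i] by (simp add: lookup_minus)
      qed
      ultimately show ?thesis using c by (simp add: mg_matrix_def lookup_single_times comp_at_def)
    qed (simp add: mg_matrix_def)
    then show ?thesis using True by (simp add: comp_at_def[of b] mat_app_def lookup_sum)
  next
    case False
    have "lam r c * comp_at b' a' v m c = 0" if "c < b'" for c
    proof (cases "lam r c = 0")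
      case nz: False
      then have "\<not> mon_le (a' c) m"
        using lam[OF that nz] False mon_le_trans[of "a r" "a' c" m] by blast
      then show ?thesis by (simp add: comp_at_def)
    qed simp
    then show ?thesis using False by (auto simp: comp_at_def[of b])
  qed
qed

lemma comp_at_keys:
  assumes "v \<in> free_mod n b" "\<And>c. c < b \<Longrightarrow> Poly_Mapping.keys (a c) \<subseteq> {1..n}" "comp_at b a v m \<noteq> (\<lambda>_. 0)"
  shows "Poly_Mapping.keys m \<subseteq> {1..n}"
proof -
  obtain c where c: "c < b" "mon_le (a c) m" "Poly_Mapping.lookup (v c) (m - a c) \<noteq> 0"
    using assms(3) by (auto simp: comp_at_def fun_eq_iff split: if_splits)
  then have "Poly_Mapping.keys (m - a c) \<subseteq> {1..n}"
    using assms(1) by (simp add: free_mod_def poly_ring_iff)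
  then have "Poly_Mapping.keys (m - a c + a c) \<subseteq> {1..n}"
    using assms(2) c(1) by (simp add: keys_add_mon)
  then show ?thesis using c(2) by (simp add: mon_le_diff_add)
qed

lemma finite_comp_at: "finite {m. comp_at b a v m \<noteq> (\<lambda>_. 0)}"
proof (rule finite_subset)
  show "{m. comp_at b a v m \<noteq> (\<lambda>_. 0)} \<subseteq> (\<Union>c<b. (\<lambda>t. t + a c) ` Poly_Mapping.keys (v c))"
  proof
    fix m assume "m \<in> {m. comp_at b a v m \<noteq> (\<lambda>_. 0)}"
    then obtain c where "c < b" "mon_le (a c) m" "Poly_Mapping.lookup (v c) (m - a c) \<noteq> 0"
      by (auto simp: comp_at_def fun_eq_iff split: if_splits)
    then have "c \<in> {..<b}" "m = (m - a c) + a c" "m - a c \<in> Poly_Mapping.keys (v c)"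
      by (auto simp: mon_le_diff_add in_keys_iff)
    then show "m \<in> (\<Union>c<b. (\<lambda>t. t + a c) ` Poly_Mapping.keys (v c))" by blast
  qed
qed simp

text \<open>Finitely many nonzero components make each coordinate finitely supported, hence a
  polynomial; the condition on supports keeps it inside R.\<close>

lemma comp_at_surj:
  fixes Z :: "(nat \<Rightarrow>\<^sub>0 nat) \<Rightarrow> nat \<Rightarrow> 'k::comm_ring_1"
  assumes supp: "\<And>m c. Z m c \<noteq> 0 \<Longrightarrow> c < b \<and> mon_le (a c) m"
    and fin: "finite {m. Z m \<noteq> (\<lambda>_. 0)}"
    and keys: "\<And>m. Z m \<noteq> (\<lambda>_. 0) \<Longrightarrow> Poly_Mapping.keys m \<subseteq> {1..n}"
  shows "\<exists>w\<in>free_mod n b. \<forall>m. comp_at b a w m = Z m"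
proof (intro bexI allI)
  let ?w = "\<lambda>c. Abs_poly_mapping (\<lambda>t. Z (t + a c) c)"
  have lookup_w: "Poly_Mapping.lookup (?w c) t = Z (t + a c) c" for c t
  proof -
    have "finite ((\<lambda>t. t + a c) -` {m. Z m \<noteq> (\<lambda>_. 0)})"
      by (rule finite_vimageI[OF fin]) (simp add: inj_on_def)
    then have "finite {t. Z (t + a c) c \<noteq> 0}"
      by (rule rev_finite_subset) auto
    then show ?thesis by simp
  qed
  show "?w \<in> free_mod n b"
    unfolding free_mod_def
  proof (intro CollectI conjI allI impI)
    fix c show "?w c \<in> poly_ring n"
      unfolding poly_ring_iff lookup_w
    proof (intro allI impI)
      fix m assume "Z (m + a c) c \<noteq> 0"
      then have "Poly_Mapping.keys (m + a c) \<subseteq> {1..n}" by (intro keys) auto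
      then show "Poly_Mapping.keys m \<subseteq> {1..n}" by (simp add: keys_add_mon)
    qed
  next
    fix c assume "b \<le> c"
    then have "(\<lambda>t. Z (t + a c) c) = (\<lambda>_. 0)" using supp[of _ c] by fastforce
    then show "?w c = 0" by simp
  qed
  show "comp_at b a ?w m = Z m" for m
  proof
    fix c show "comp_at b a ?w m c = Z m c"
      using supp[of m c] unfolding comp_at_def lookup_w by (auto simp: mon_le_diff_add)
  qed
qed

lemma comp_at_in_img_iff:
  assumes lam: "\<And>r c. c < b' \<Longrightarrow> lam r c \<noteq> 0 \<Longrightarrow> r < b \<and> mon_le (a r) (a' c)"
    and keys: "\<And>c. c < b \<Longrightarrow> Poly_Mapping.keys (a c) \<subseteq> {1..n}"
      "\<And>c. c < b' \<Longrightarrow> Poly_Mapping.keys (a' c) \<subseteq> {1..n}"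
    and v: "v \<in> free_mod n b"
  shows "v \<in> mat_app (mg_matrix a a' lam) b b' ` free_mod n b' \<longleftrightarrow>
    (\<forall>m. comp_at b a v m \<in> img_at b' a' lam m)"
proof -
  have comp: "comp_at b a (mat_app (mg_matrix a a' lam) b b' w) m = (\<lambda>r. \<Sum>c<b'. lam r c * comp_at b' a' w m c)"
    for w m by (rule comp_at_mat_app) (rule lam)
  show ?thesis
  proof
    assume "v \<in> mat_app (mg_matrix a a' lam) b b' ` free_mod n b'"
    then obtain w where w: "v = mat_app (mg_matrix a a' lam) b b' w" by blast
    have "comp_at b a v m \<in> img_at b' a' lam m" for m
      unfolding w comp img_at_def
      by (intro CollectI exI[of _ "comp_at b' a' w m"]) (auto simp: comp_at_def)
    then show "\<forall>m. comp_at b a v m \<in> img_at b' a' lam m" by blast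
  next
    assume "\<forall>m. comp_at b a v m \<in> img_at b' a' lam m"
    then have "\<forall>m. \<exists>z. (\<forall>j. z j \<noteq> 0 \<longrightarrow> j < b' \<and> mon_le (a' j) m) \<and>
        (\<forall>r. comp_at b a v m r = (\<Sum>j<b'. lam r j * z j))"
      by (simp add: img_at_def)
    then obtain Z' where Z': "\<And>m j. Z' m j \<noteq> 0 \<Longrightarrow> j < b' \<and> mon_le (a' j) m"
        "\<And>m r. comp_at b a v m r = (\<Sum>j<b'. lam r j * Z' m j)" by metis
    \<comment> \<open>Arbitrary preimages in infinitely many degrees need not form a polynomial
      vector; choosing 0 wherever the component of \<open>v\<close> vanishes keeps the support
      finite.\<close>
    define Z where "Z m = (if comp_at b a v m = (\<lambda>_. 0) then (\<lambda>_. 0) else Z' m)" for m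
    have "Z m j \<noteq> 0 \<Longrightarrow> j < b' \<and> mon_le (a' j) m" for m j
      using Z'(1) by (simp add: Z_def split: if_splits)
    moreover have "finite {m. Z m \<noteq> (\<lambda>_. 0)}"
      by (rule finite_subset[OF _ finite_comp_at[of b a v]]) (auto simp: Z_def)
    moreover have "Z m \<noteq> (\<lambda>_. 0) \<Longrightarrow> Poly_Mapping.keys m \<subseteq> {1..n}" for m
      using comp_at_keys[OF v keys(1), where m = m] by (auto simp: Z_def split: if_splits)
    ultimately have "\<exists>w\<in>free_mod n b'. \<forall>m. comp_at b' a' w m = Z m"
      by (rule comp_at_surj)
    then obtain w where w: "w \<in> free_mod n b'" "\<And>m. comp_at b' a' w m = Z m" by blast
    have "v = mat_app (mg_matrix a a' lam) b b' w"
    proof (rule comp_at_inj[OF v])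
      show "mat_app (mg_matrix a a' lam) b b' w \<in> free_mod n b"
      proof (rule mat_app_free_mod[OF _ w(1)])
        fix r c assume "r < b" "c < b'"
        then have "Poly_Mapping.keys (a' c - a r) \<subseteq> {1..n}"
          using keys(2)[of c] keys_diff_mon[of "a' c" "a r"] by blast
        then show "mg_matrix a a' lam r c \<in> poly_ring n"
          unfolding mg_matrix_def by (rule poly_ring_single)
      qed
      show "comp_at b a v m = comp_at b a (mat_app (mg_matrix a a' lam) b b' w) m" for m
        by (rule ext, cases "comp_at b a v m = (\<lambda>_. 0)") (simp_all add: comp w(2) Z_def Z'(2)[symmetric])
    qed
    then show "v \<in> mat_app (mg_matrix a a' lam) b b' ` free_mod n b'" using w(1) by blast
  qed
qed

lemma comp_at_in_ker_iff:
  fixes lam :: "nat \<Rightarrow> nat \<Rightarrow> 'k::field"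
  assumes lam: "\<And>r c. c < b \<Longrightarrow> lam r c \<noteq> 0 \<Longrightarrow> r < b0 \<and> mon_le (a0 r) (a c)"
    and keys: "\<And>c. c < b \<Longrightarrow> Poly_Mapping.keys (a c) \<subseteq> {1..n}"
    and v: "v \<in> free_mod n b"
  shows "mat_app (mg_matrix a0 a lam) b0 b v = (\<lambda>_. 0) \<longleftrightarrow> (\<forall>m. comp_at b a v m \<in> ker_at b0 b a lam m)"
proof -
  have comp: "comp_at b0 a0 (mat_app (mg_matrix a0 a lam) b0 b v) m = (\<lambda>r. \<Sum>c<b. lam r c * comp_at b a v m c)"
    for m by (rule comp_at_mat_app) (rule lam)
  have eq0: "comp_at b0 a0 (mat_app (mg_matrix a0 a lam) b0 b v) m = (\<lambda>_. 0) \<longleftrightarrow>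
      comp_at b a v m \<in> ker_at b0 b a lam m" for m
  proof -
    have "(\<Sum>c<b. lam r c * comp_at b a v m c) = 0" if "\<not> r < b0" for r
      using lam that by (intro sum.neutral) fastforce
    then have "(\<forall>r. (\<Sum>c<b. lam r c * comp_at b a v m c) = 0) \<longleftrightarrow>
        (\<forall>r<b0. (\<Sum>c<b. lam r c * comp_at b a v m c) = 0)" by blast
    moreover have "c < b \<and> mon_le (a c) m" if "comp_at b a v m c \<noteq> 0" for c
      using that by (simp add: comp_at_def split: if_splits)
    ultimately show ?thesis
      unfolding comp ker_at_def fun_eq_iff by blast
  qed
  have "mat_app (mg_matrix a0 a lam) b0 b v \<in> free_mod n b0"
  proof (rule mat_app_free_mod[OF _ v])
    fix r c assume "r < b0" "c < b"
    then have "Poly_Mapping.keys (a c - a0 r) \<subseteq> {1..n}"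
      using keys[of c] keys_diff_mon[of "a c" "a0 r"] by blast
    then show "mg_matrix a0 a lam r c \<in> poly_ring n"
      unfolding mg_matrix_def by (rule poly_ring_single)
  qed
  note free = this
  have zero: "comp_at b0 a0 (\<lambda>_. 0 :: 'k mpoly) m = (\<lambda>_. 0)" for m
    by (simp add: comp_at_def fun_eq_iff)
  have "mat_app (mg_matrix a0 a lam) b0 b v = (\<lambda>_. 0) \<longleftrightarrow>
      (\<forall>m. comp_at b0 a0 (mat_app (mg_matrix a0 a lam) b0 b v) m = (\<lambda>_. 0))" (is "?l = ?r")
  proof
    assume ?l
    then show ?r by (simp only: zero simp_thms)
  next
    assume ?r
    then show ?l by (intro comp_at_inj[OF free free_mod_zero, of a0]) (simp only: zero)
  qed
  then show ?thesis by (simp add: eq0)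
qed

lemma ex_min_graded_free_res:
  assumes \<Gamma>: "\<And>S T. S \<in> \<Gamma> \<Longrightarrow> T \<subseteq> S \<Longrightarrow> T \<in> \<Gamma>" "{} \<in> \<Gamma>"
  shows "\<exists>F. min_graded_free_res n (nonface_ideal n \<Gamma> :: ('k::field) mpoly set) F"
proof (rule multigraded_resolution[of \<Gamma> n])
  fix B :: "nat \<Rightarrow> nat" and A :: "nat \<Rightarrow> nat \<Rightarrow> nat \<Rightarrow>\<^sub>0 nat" and L :: "nat \<Rightarrow> nat \<Rightarrow> nat \<Rightarrow> 'k" assume
    B0: "B 0 = 1" and A0: "A 0 = (\<lambda>_. 0)" and
    keysA: "\<And>i c. c < B i \<Longrightarrow> Poly_Mapping.keys (A i c) \<subseteq> {1..n}" and
    LA: "\<And>i r c. c < B (Suc i) \<Longrightarrow> L i r c \<noteq> 0 \<Longrightarrow>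
        r < B i \<and> mon_le (A i r) (A (Suc i) c) \<and> A i r \<noteq> A (Suc i) c" and
    img: "\<And>m. nonface_at n \<Gamma> m = img_at (B 1) (A 1) (L 0) m" and
    exact: "\<And>i m. ker_at (B i) (B (Suc i)) (A (Suc i)) (L i) m =
        img_at (B (Suc (Suc i))) (A (Suc (Suc i))) (L (Suc i)) m"
  have LA': "c < B (Suc i) \<Longrightarrow> L i r c \<noteq> 0 \<Longrightarrow> r < B i \<and> mon_le (A i r) (A (Suc i) c)" for i r c
    using LA by blast
  have img_iff: "v \<in> mat_app (mg_matrix (A i) (A (Suc i)) (L i)) (B i) (B (Suc i)) ` free_mod n (B (Suc i)) \<longleftrightarrow>
      (\<forall>m. comp_at (B i) (A i) v m \<in> img_at (B (Suc i)) (A (Suc i)) (L i) m)"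
    if "v \<in> free_mod n (B i)" for v i
    by (rule comp_at_in_img_iff) (fact LA' keysA that)+
  have ker_iff: "mat_app (mg_matrix (A i) (A (Suc i)) (L i)) (B i) (B (Suc i)) v = (\<lambda>_. 0) \<longleftrightarrow>
      (\<forall>m. comp_at (B (Suc i)) (A (Suc i)) v m \<in> ker_at (B i) (B (Suc i)) (A (Suc i)) (L i) m)"
    if "v \<in> free_mod n (B (Suc i))" for v i
    by (rule comp_at_in_ker_iff) (fact LA' keysA that)+
  define M where "M i = mg_matrix (A i) (A (Suc i)) (L i)" for i
  have M_poly: "M i r c \<in> poly_ring n" if "c < B (Suc i)" for i r c
  proof -
    have "Poly_Mapping.keys (A (Suc i) c - A i r) \<subseteq> {1..n}"
      using keysA[OF that] keys_diff_mon[of "A (Suc i) c" "A i r"] by blast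
    then show ?thesis by (simp add: M_def mg_matrix_def poly_ring_single)
  qed
  have M_app: "mat_app (M i) (B i) (B (Suc i)) w \<in> free_mod n (B i)"
    if "w \<in> free_mod n (B (Suc i))" for w i
    by (rule mat_app_free_mod[OF M_poly that])
  \<comment> \<open>Shifts are the total degrees of the multidegrees. \<open>M\<close> is indexed by
    the target of a map and \<open>dm\<close> by its source, hence \<open>i - 1\<close>.\<close>
  let ?F = "(B, \<lambda>i c. mon_deg (A i c), \<lambda>i. M (i - 1)) :: 'k gres"
  have "min_graded_free_res n (nonface_ideal n \<Gamma>) ?F"
    unfolding min_graded_free_res_def rk_def sh_def dm_def fst_conv snd_conv
  proof (intro conjI allI impI)
    show "B 0 = 1" "mon_deg (A 0 0) = 0" by (simp_all add: B0 A0)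
  next
    fix i r c :: nat assume i: "1 \<le> i" and r: "r < B (i - 1)" and c: "c < B i"
    then obtain j where j: "i = Suc j" by (cases i) auto
    show "M (i - 1) r c \<in> poly_ring n" using M_poly[of c j r] c j by simp
    show "homogeneous (int (mon_deg (A i c)) - int (mon_deg (A (i - 1) r))) (M (i - 1) r c)"
    proof (cases "L j r c = 0")
      case False
      then have "A i c = A i c - A j r + A j r" using LA[of c j r] c j by (simp add: mon_le_diff_add)
      then have "mon_deg (A i c) = mon_deg (A i c - A j r) + mon_deg (A j r)"
        by (metis mon_deg_add)
      then show ?thesis by (simp add: homogeneous_def M_def mg_matrix_def j)
    qed (simp add: homogeneous_def M_def mg_matrix_def j)
    show "Poly_Mapping.lookup (M (i - 1) r c) 0 = 0"
    proof (cases "L j r c = 0")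
      case False
      then have "A i c - A j r \<noteq> 0" using LA[of c j r] c j mon_le_diff_add[of "A j r" "A i c"] by auto
      then show ?thesis by (simp add: M_def mg_matrix_def j lookup_single)
    qed (simp add: M_def mg_matrix_def j)
  next
    show "{p. (\<lambda>r. if r = 0 then p else 0) \<in> mat_app (M (1 - 1)) 1 (B 1) ` free_mod n (B 1)} =
      nonface_ideal n \<Gamma>"
    proof (intro set_eqI)
      fix p :: "'k mpoly"
      let ?v = "\<lambda>r::nat. if r = 0 then p else 0"
      have v_iff: "?v \<in> mat_app (M 0) 1 (B 1) ` free_mod n (B 1) \<longleftrightarrow> p \<in> nonface_ideal n \<Gamma>"
        if p: "p \<in> poly_ring n"
      proof -
        have "?v \<in> free_mod n (B 0)" using p by (simp add: free_mod_def B0)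
        from img_iff[OF this]
        have "?v \<in> mat_app (M 0) 1 (B 1) ` free_mod n (B 1) \<longleftrightarrow>
            (\<forall>m. comp_at (B 0) (A 0) ?v m \<in> nonface_at n \<Gamma> m)"
          unfolding img by (simp add: M_def B0)
        also have "\<dots> \<longleftrightarrow> (\<forall>m. Poly_Mapping.lookup p m \<noteq> 0 \<longrightarrow> Poly_Mapping.keys m \<inter> {1..n} \<notin> \<Gamma>)"
          by (auto simp: comp_at_def nonface_at_def A0 B0)
        also have "\<dots> \<longleftrightarrow> p \<in> nonface_ideal n \<Gamma>"
          using p by (auto simp: nonface_ideal_def poly_ring_iff in_keys_iff Int_absorb2)
        finally show ?thesis .
      qed
      moreover have "p \<in> poly_ring n" if v_img: "?v \<in> mat_app (M 0) 1 (B 1) ` free_mod n (B 1)"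
      proof -
        obtain w where w: "?v = mat_app (M 0) 1 (B 1) w" "w \<in> free_mod n (B 1)"
          by (rule imageE[OF v_img])
        have "mat_app (M 0) 1 (B 1) w 0 \<in> poly_ring n"
          using M_app[of w 0] w(2) B0 by (simp add: free_mod_def)
        then show ?thesis unfolding w(1)[symmetric] by simp
      qed
      moreover have "p \<in> poly_ring n" if "p \<in> nonface_ideal n \<Gamma>"
        using that by (simp add: nonface_ideal_def)
      ultimately show "p \<in> {p. (\<lambda>r. if r = 0 then p else 0) \<in> mat_app (M (1 - 1)) 1 (B 1) ` free_mod n (B 1)}
          \<longleftrightarrow> p \<in> nonface_ideal n \<Gamma>"
        unfolding mem_Collect_eq diff_self_eq_0 by argo
    qed
  next
    fix i :: nat assume "1 \<le> i"
    then obtain j where j: "i = Suc j" by (cases i) auto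
    have ker: "mat_app (M j) (B j) (B (Suc j)) v = (\<lambda>_. 0) \<longleftrightarrow>
        v \<in> mat_app (M (Suc j)) (B (Suc j)) (B (Suc (Suc j))) ` free_mod n (B (Suc (Suc j)))"
      if v: "v \<in> free_mod n (B (Suc j))" for v
      unfolding M_def img_iff[OF v] ker_iff[OF v] exact by blast
    moreover have "mat_app (M (Suc j)) (B (Suc j)) (B (Suc (Suc j))) w \<in> free_mod n (B (Suc j))"
      if "w \<in> free_mod n (B (Suc (Suc j)))" for w
      using that by (rule M_app)
    ultimately show "{v \<in> free_mod n (B i). mat_app (M (i - 1)) (B (i - 1)) (B i) v = (\<lambda>_. 0)} =
        mat_app (M (Suc i - 1)) (B i) (B (Suc i)) ` free_mod n (B (Suc i))"
      by (auto simp: j)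
  qed
  then show ?thesis by blast
qed (fact \<Gamma>)+

subsection \<open>Quadratic Koszul cycles\<close>

abbreviation var_poly :: "nat \<Rightarrow> ('k::comm_ring_1) mpoly" where
  "var_poly s \<equiv> Poly_Mapping.single (Poly_Mapping.single s 1) 1"

lemma mon_deg_1:
  assumes "mon_deg m = 1"
  obtains s where "m = Poly_Mapping.single s 1"
proof -
  have "m \<noteq> 0" using assms by auto
  then obtain s where s: "Poly_Mapping.lookup m s \<noteq> 0"
    by (metis lookup_zero poly_mapping_eqI)
  then have "mon_le (Poly_Mapping.single s 1) m"
    by (auto simp: mon_le_def lookup_single when_def)
  then have "Poly_Mapping.single s 1 + (m - Poly_Mapping.single s 1) = m"
    by (rule mon_le_add_diff)
  moreover from this have "mon_deg (m - Poly_Mapping.single s 1) = 0"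
    using assms mon_deg_add[of "Poly_Mapping.single s 1" "m - Poly_Mapping.single s 1"] by simp
  ultimately show ?thesis using that[of s] by simp
qed

lemma card_keys_le_mon_deg: "card (Poly_Mapping.keys m) \<le> mon_deg m"
proof -
  have "(\<Sum>i\<in>Poly_Mapping.keys m. 1) \<le> mon_deg m"
    unfolding mon_deg_def by (rule sum_mono) (simp add: in_keys_iff)
  then show ?thesis by simp
qed

lemma mon_deg_mono: "mon_le a b \<Longrightarrow> mon_deg b = mon_deg a + mon_deg (b - a)"
  by (metis mon_deg_add mon_le_add_diff)

lemma mon_le_mon_deg_eq:
  assumes "mon_le a m" "mon_deg m \<le> mon_deg a"
  shows "a = m"
proof -
  have "mon_deg (m - a) = 0" using mon_deg_mono[OF assms(1)] assms(2) by linarith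
  then show ?thesis using mon_le_add_diff[OF assms(1)] by simp
qed

lemma single_add_single_eq_iff:
  "Poly_Mapping.single a (1::nat) + Poly_Mapping.single b 1 = Poly_Mapping.single s 1 + Poly_Mapping.single t 1
    \<longleftrightarrow> (a = s \<and> b = t) \<or> (a = t \<and> b = s)" (is "?l \<longleftrightarrow> ?r")
proof
  assume ?l
  then have eq: "Poly_Mapping.lookup (Poly_Mapping.single a (1::nat)) i + Poly_Mapping.lookup (Poly_Mapping.single b 1) i =
      Poly_Mapping.lookup (Poly_Mapping.single s (1::nat)) i + Poly_Mapping.lookup (Poly_Mapping.single t 1) i" for i
    by (metis lookup_add)
  show ?r
    using eq[of a] eq[of b] by (auto simp: lookup_single when_def split: if_splits)
qed (auto simp: add.commute)

text \<open>The coefficient of x_s x_t is \<open>b s t + b t s\<close> off the diagonal and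
  \<open>b s s\<close> on it. On the diagonal antisymmetry says only 2 \<open>b s s\<close> = 0,
  which is where characteristic zero enters: interchanging the indices shows that the form equals
  its own negative.\<close>

lemma quadratic_form_eq_0_iff:
  fixes b :: "nat \<Rightarrow> nat \<Rightarrow> 'k::field_char_0"
  assumes "finite S"
  shows "(\<Sum>s\<in>S. \<Sum>t\<in>S. var_poly s * (var_poly t * Poly_Mapping.single 0 (b s t))) = 0 \<longleftrightarrow>
    (\<forall>s\<in>S. \<forall>t\<in>S. b s t = - b t s)"
proof -
  let ?X = "\<lambda>s. Poly_Mapping.single s (1::nat)"
  let ?Q = "\<Sum>s\<in>S. \<Sum>t\<in>S. Poly_Mapping.single (?X s + ?X t) (b s t)"
  have Q: "(\<Sum>s\<in>S. \<Sum>t\<in>S. var_poly s * (var_poly t * Poly_Mapping.single 0 (b s t))) = ?Q"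
    by (simp add: mult_single)
  show ?thesis
    unfolding Q
  proof
    assume Q0: "?Q = 0"
    show "\<forall>s\<in>S. \<forall>t\<in>S. b s t = - b t s"
    proof (intro ballI)
      fix s t assume st: "s \<in> S" "t \<in> S"
      have "0 = Poly_Mapping.lookup ?Q (?X s + ?X t)" by (subst Q0) simp
      also have "\<dots> = (\<Sum>u\<in>S. \<Sum>v\<in>S. if (u = s \<and> v = t) \<or> (u = t \<and> v = s) then b u v else 0)"
        unfolding lookup_sum lookup_single when_def single_add_single_eq_iff by simp
      finally have *: "(\<Sum>u\<in>S. \<Sum>v\<in>S. if (u = s \<and> v = t) \<or> (u = t \<and> v = s) then b u v else 0) = 0" by simp
      show "b s t = - b t s"
      proof (cases "s = t")
        case True
        have "(\<Sum>u\<in>S. \<Sum>v\<in>S. if (u = s \<and> v = t) \<or> (u = t \<and> v = s) then b u v else 0) =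
            (\<Sum>u\<in>S. if u = s then (\<Sum>v\<in>S. if v = s then b s s else 0) else 0)"
          by (intro sum.cong) (auto simp: True intro!: sum.cong)
        also have "\<dots> = b s s" using st assms by simp
        finally show ?thesis using * True by simp
      next
        case False
        have "(\<Sum>u\<in>S. \<Sum>v\<in>S. if (u = s \<and> v = t) \<or> (u = t \<and> v = s) then b u v else 0) =
            (\<Sum>u\<in>S. (if u = s then (\<Sum>v\<in>S. if v = t then b s t else 0) else 0) +
               (if u = t then (\<Sum>v\<in>S. if v = s then b t s else 0) else 0))"
          by (intro sum.cong) (use False in \<open>auto intro!: sum.cong\<close>)
        also have "\<dots> = b s t + b t s" using st assms by (simp add: sum.distrib)
        finally show ?thesis using * by (simp add: eq_neg_iff_add_eq_0)
      qed
    qed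
  next
    assume anti: "\<forall>s\<in>S. \<forall>t\<in>S. b s t = - b t s"
    have "?Q = (\<Sum>t\<in>S. \<Sum>s\<in>S. Poly_Mapping.single (?X s + ?X t) (b s t))"
      by (rule sum.swap)
    also have "\<dots> = (\<Sum>t\<in>S. \<Sum>s\<in>S. - Poly_Mapping.single (?X t + ?X s) (b t s))"
    proof (intro sum.cong refl)
      fix s t assume "t \<in> S" "s \<in> S"
      then have "b s t = - b t s" using anti by blast
      then show "Poly_Mapping.single (?X s + ?X t) (b s t) = - Poly_Mapping.single (?X t + ?X s) (b t s)"
        by (simp add: single_uminus add.commute)
    qed
    also have "\<dots> = - ?Q" by (simp add: sum_negf)
    finally have "?Q = - ?Q" .
    moreover have "q = 0" if "q = - q" for q :: "'k mpoly"
    proof (rule poly_mapping_eqI)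
      fix m
      have "Poly_Mapping.lookup q m = - Poly_Mapping.lookup q m" by (metis that lookup_uminus)
      then show "Poly_Mapping.lookup q m = Poly_Mapping.lookup 0 m" by simp
    qed
    ultimately show "?Q = 0" by blast
  qed
qed

text \<open>An element of the tensor product of the \<open>j\<close>-th exterior power of the span of the variables with the quadratic
  part of the Stanley--Reisner ideal is encoded as an alternating function on lists of \<open>j\<close> indices; the last
  clause is the cycle condition.\<close>

definition koszul_cycle :: "nat \<Rightarrow> nat set set \<Rightarrow> nat \<Rightarrow> (nat list \<Rightarrow> ('k::comm_ring_1) mpoly) \<Rightarrow> bool" where
  "koszul_cycle n \<Gamma> j f \<longleftrightarrow>
    (\<forall>l. length l = j \<and> set l \<subseteq> {1..n} \<longrightarrow>
       f l \<in> nonface_ideal n \<Gamma> \<and> (\<forall>m. Poly_Mapping.lookup (f l) m \<noteq> 0 \<longrightarrow> mon_deg m = 2)) \<and>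
    (\<forall>xs a b ys. length (xs @ a # b # ys) = j \<and> set (xs @ a # b # ys) \<subseteq> {1..n} \<longrightarrow>
       f (xs @ a # b # ys) = - f (xs @ b # a # ys)) \<and>
    (\<forall>l. Suc (length l) = j \<and> set l \<subseteq> {1..n} \<longrightarrow> (\<Sum>s\<in>{1..n}. var_poly s * f (l @ [s])) = 0)"

text \<open>The cycle condition sums over the last index while the first one is held fixed, so the
  two do not interfere. This permits induction on the number of indices.\<close>

lemma koszul_cycle_Cons:
  assumes "koszul_cycle n \<Gamma> (Suc j) f" "s \<in> {1..n}"
  shows "koszul_cycle n \<Gamma> j (\<lambda>l. f (s # l))"
  unfolding koszul_cycle_def
proof (intro conjI allI impI)
  fix l assume "length l = j \<and> set l \<subseteq> {1..n}"
  then have "length (s # l) = Suc j \<and> set (s # l) \<subseteq> {1..n}" using assms(2) by simp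
  then show "f (s # l) \<in> nonface_ideal n \<Gamma>" "Poly_Mapping.lookup (f (s # l)) m \<noteq> 0 \<Longrightarrow> mon_deg m = 2" for m
    using assms(1) unfolding koszul_cycle_def by blast+
next
  fix xs a b ys assume "length (xs @ a # b # ys) = j \<and> set (xs @ a # b # ys) \<subseteq> {1..n}"
  then have "length ((s # xs) @ a # b # ys) = Suc j \<and> set ((s # xs) @ a # b # ys) \<subseteq> {1..n}"
    using assms(2) by simp
  then have "f ((s # xs) @ a # b # ys) = - f ((s # xs) @ b # a # ys)"
    using assms(1) unfolding koszul_cycle_def by blast
  then show "f (s # xs @ a # b # ys) = - f (s # xs @ b # a # ys)" by simp
next
  fix l assume "Suc (length l) = j \<and> set l \<subseteq> {1..n}"
  then have "Suc (length (s # l)) = Suc j \<and> set (s # l) \<subseteq> {1..n}" using assms(2) by simp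
  then have "(\<Sum>t\<in>{1..n}. var_poly t * f ((s # l) @ [t])) = 0"
    using assms(1) unfolding koszul_cycle_def by blast
  then show "(\<Sum>t\<in>{1..n}. var_poly t * f (s # l @ [t])) = 0" by simp
qed

subsection \<open>The linear strand of a minimal resolution\<close>

text \<open>Any minimal resolution is allowed, since \<open>betti\<close> may pick any.
  \<open>small_faces\<close> says that the ideal contains no constants and no linear forms.\<close>

locale flag_resolution =
  fixes n :: nat and \<Gamma> :: "nat set set" and F :: "('k::field_char_0) gres"
  assumes res: "min_graded_free_res n (nonface_ideal n \<Gamma> :: 'k mpoly set) F"
    and small_faces: "\<And>S. S \<subseteq> {1..n} \<Longrightarrow> card S \<le> 1 \<Longrightarrow> S \<in> \<Gamma>"
begin

definition D :: "nat \<Rightarrow> (nat \<Rightarrow> 'k mpoly) \<Rightarrow> nat \<Rightarrow> 'k mpoly" where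
  "D i = mat_app (dm F (Suc i)) (rk F i) (rk F (Suc i))"

definition const_vec :: "(nat \<Rightarrow> 'k) \<Rightarrow> nat \<Rightarrow> 'k mpoly" where
  "const_vec w = (\<lambda>c. Poly_Mapping.single 0 (w c))"

text \<open>Coefficient vectors of the basis elements of degree i + 2 in module i + 1. The index is
  shifted so that an element of \<open>strand i\<close> corresponds to a cycle with i exterior
  indices.\<close>

definition strand :: "nat \<Rightarrow> (nat \<Rightarrow> 'k) set" where
  "strand i = {w. \<forall>c. w c \<noteq> 0 \<longrightarrow> c < rk F (Suc i) \<and> sh F (Suc i) c = i + 2}"

text \<open>The coefficient of x_s in the linear part of the differential, a scalar map from
  \<open>strand (Suc i)\<close> to \<open>strand i\<close>.\<close>

definition partial :: "nat \<Rightarrow> nat \<Rightarrow> (nat \<Rightarrow> 'k) \<Rightarrow> nat \<Rightarrow> 'k" where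
  "partial i s w = (\<lambda>r. if r < rk F (Suc i)
     then (\<Sum>c<rk F (Suc (Suc i)). Poly_Mapping.lookup (dm F (Suc (Suc i)) r c) (Poly_Mapping.single s 1) * w c)
     else 0)"

text \<open>The final map into R is treated apart: on the strand its entries are quadratic, not
  linear.\<close>

definition augment :: "(nat \<Rightarrow> 'k) \<Rightarrow> 'k mpoly" where
  "augment w = D 0 (const_vec w) 0"

lemma rk_0: "rk F 0 = 1" and sh_0: "sh F 0 0 = 0"
  using res by (simp_all add: min_graded_free_res_def)

lemma dm_props:
  assumes "r < rk F i" "c < rk F (Suc i)"
  shows dm_poly: "dm F (Suc i) r c \<in> poly_ring n"
    and dm_const: "Poly_Mapping.lookup (dm F (Suc i) r c) 0 = 0"
    and dm_deg: "Poly_Mapping.lookup (dm F (Suc i) r c) m \<noteq> 0 \<Longrightarrow> mon_deg m + sh F i r = sh F (Suc i) c"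
proof -
  have *: "\<forall>i\<ge>1. \<forall>r<rk F (i - 1). \<forall>c<rk F i.
        dm F i r c \<in> poly_ring n \<and>
        homogeneous (int (sh F i c) - int (sh F (i - 1) r)) (dm F i r c) \<and>
        Poly_Mapping.lookup (dm F i r c) 0 = 0"
    using res by (simp add: min_graded_free_res_def)
  have **: "dm F (Suc i) r c \<in> poly_ring n \<and>
        homogeneous (int (sh F (Suc i) c) - int (sh F i r)) (dm F (Suc i) r c) \<and>
        Poly_Mapping.lookup (dm F (Suc i) r c) 0 = 0"
    using *[rule_format, of "Suc i" r c] assms by simp
  then show "dm F (Suc i) r c \<in> poly_ring n" "Poly_Mapping.lookup (dm F (Suc i) r c) 0 = 0" by simp_all
  show "mon_deg m + sh F i r = sh F (Suc i) c" if "Poly_Mapping.lookup (dm F (Suc i) r c) m \<noteq> 0"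
  proof -
    have "int (mon_deg m) = int (sh F (Suc i) c) - int (sh F i r)"
      using ** that by (simp add: homogeneous_def in_keys_iff)
    then show ?thesis by linarith
  qed
qed

lemma ideal_iff:
  "p \<in> nonface_ideal n \<Gamma> \<longleftrightarrow> (\<exists>u\<in>free_mod n (rk F 1). (\<lambda>r. if r = 0 then p else 0) = D 0 u)"
proof -
  have "{p. (\<lambda>r. if r = 0 then p else 0) \<in> mat_app (dm F 1) 1 (rk F 1) ` free_mod n (rk F 1)} = nonface_ideal n \<Gamma>"
    using res by (simp add: min_graded_free_res_def)
  then have "p \<in> nonface_ideal n \<Gamma> \<longleftrightarrow>
      (\<lambda>r. if r = 0 then p else 0) \<in> mat_app (dm F 1) 1 (rk F 1) ` free_mod n (rk F 1)" by blast
  then show ?thesis by (simp add: D_def rk_0 image_iff)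
qed

lemma D_exact:
  assumes "v \<in> free_mod n (rk F (Suc i))"
  shows "D i v = (\<lambda>_. 0) \<longleftrightarrow> (\<exists>u\<in>free_mod n (rk F (Suc (Suc i))). v = D (Suc i) u)"
proof -
  have "{v \<in> free_mod n (rk F (Suc i)). mat_app (dm F (Suc i)) (rk F (Suc i - 1)) (rk F (Suc i)) v = (\<lambda>_. 0)}
             = mat_app (dm F (Suc (Suc i))) (rk F (Suc i)) (rk F (Suc (Suc i))) ` free_mod n (rk F (Suc (Suc i)))"
  proof -
    have *: "\<forall>i\<ge>1. {v \<in> free_mod n (rk F i). mat_app (dm F i) (rk F (i - 1)) (rk F i) v = (\<lambda>_. 0)}
             = mat_app (dm F (Suc i)) (rk F i) (rk F (Suc i)) ` free_mod n (rk F (Suc i))"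
      using res unfolding min_graded_free_res_def by (elim conjE)
    show ?thesis using *[rule_format, of "Suc i"] by simp
  qed
  then have "{v \<in> free_mod n (rk F (Suc i)). D i v = (\<lambda>_. 0)} = D (Suc i) ` free_mod n (rk F (Suc (Suc i)))"
    by (simp add: D_def)
  then show ?thesis using assms by blast
qed

section \<open>Consequences of minimality\<close>

lemma D_const: "Poly_Mapping.lookup (D i u r) 0 = 0"
proof (cases "r < rk F i")
  case True
  have "Poly_Mapping.lookup (dm F (Suc i) r c * u c) 0 = 0" if "c < rk F (Suc i)" for c
  proof (rule lookup_times_eq_0)
    fix a assume "Poly_Mapping.lookup (dm F (Suc i) r c) a \<noteq> 0" "mon_le a 0"
    then show "Poly_Mapping.lookup (u c) (0 - a) = 0"
      using dm_const[OF True that] mon_le_antisym[of a 0] by simp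
  qed
  then show ?thesis using True by (simp add: D_def mat_app_def lookup_sum)
qed (simp add: D_def mat_app_def)

text \<open>By exactness the kernel is the image of a matrix without constant terms. Every
  injectivity statement about the strand comes from this.\<close>

lemma kernel_const:
  assumes "v \<in> free_mod n (rk F (Suc i))" "D i v = (\<lambda>_. 0)"
  shows "Poly_Mapping.lookup (v c) 0 = 0"
  using assms D_exact D_const by metis

text \<open>A unit vector has a constant term, so by \<open>kernel_const\<close> it is not in the
  kernel: no column of the differential is zero.\<close>

lemma dm_column:
  assumes c: "c < rk F (Suc i)"
  shows unit_vec_free_mod: "(\<lambda>c'. if c' = c then 1 else (0 :: 'k mpoly)) \<in> free_mod n (rk F (Suc i))"
    and ex_dm_entry: "\<exists>r<rk F i. \<exists>m. Poly_Mapping.lookup (dm F (Suc i) r c) m \<noteq> 0 \<and>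
      D i (\<lambda>c'. if c' = c then 1 else 0) r = dm F (Suc i) r c"
proof -
    let ?e = "\<lambda>c'. if c' = c then 1 else (0 :: 'k mpoly)"
    have "1 \<in> poly_ring n" by (simp add: poly_ring_def)
    then show e: "?e \<in> free_mod n (rk F (Suc i))"
      using c by (auto simp: free_mod_def)
    have col: "D i ?e r = (if r < rk F i then dm F (Suc i) r c else 0)" for r
    proof -
      have "(\<Sum>c'<rk F (Suc i). dm F (Suc i) r c' * ?e c') = (\<Sum>c'<rk F (Suc i). if c' = c then dm F (Suc i) r c else 0)"
        by (intro sum.cong) auto
      then show ?thesis using c by (simp add: D_def mat_app_def)
    qed
    have "D i ?e \<noteq> (\<lambda>_. 0)" using kernel_const[OF e, of c] by auto
    then obtain r where "D i ?e r \<noteq> 0" by blast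
    then have "r < rk F i" "dm F (Suc i) r c \<noteq> 0" by (simp_all add: col split: if_splits)
    moreover from this(2) obtain m where "Poly_Mapping.lookup (dm F (Suc i) r c) m \<noteq> 0"
      by (metis lookup_zero poly_mapping_eqI)
    ultimately show "\<exists>r<rk F i. \<exists>m. Poly_Mapping.lookup (dm F (Suc i) r c) m \<noteq> 0 \<and> D i ?e r = dm F (Suc i) r c"
      using col by auto
  qed

text \<open>Each column has a nonzero entry, and that entry is not constant, so the shift grows by
  at least one per step. It starts at 2 because the support of a monomial in the ideal has at least
  two elements.\<close>

lemma sh_bound: "c < rk F (Suc i) \<Longrightarrow> i + 2 \<le> sh F (Suc i) c"
proof (induction i arbitrary: c)
    case 0
    let ?e = "\<lambda>c'. if c' = c then 1 else (0 :: 'k mpoly)"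
    obtain m where m: "Poly_Mapping.lookup (dm F 1 0 c) m \<noteq> 0" "D 0 ?e 0 = dm F 1 0 c"
      using ex_dm_entry[OF 0] rk_0 by auto
    have "(\<lambda>r. if r = 0 then dm F 1 0 c else 0) = D 0 ?e"
      using m(2) by (auto simp: D_def mat_app_def rk_0)
    then have "dm F 1 0 c \<in> nonface_ideal n \<Gamma>" using ideal_iff unit_vec_free_mod[OF 0] by (metis One_nat_def)
    then have "Poly_Mapping.keys m \<notin> \<Gamma>" "Poly_Mapping.keys m \<subseteq> {1..n}"
      using m(1) by (auto simp: nonface_ideal_def poly_ring_iff in_keys_iff)
    then have "2 \<le> card (Poly_Mapping.keys m)" using small_faces[of "Poly_Mapping.keys m"] by linarith
    then have "2 \<le> mon_deg m" using card_keys_le_mon_deg[of m] by linarith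
    then show ?case using dm_deg[of 0 0 c m] m(1) 0 rk_0 sh_0 by simp
  next
    case (Suc i)
    then obtain r m where r: "r < rk F (Suc i)" and m: "Poly_Mapping.lookup (dm F (Suc (Suc i)) r c) m \<noteq> 0"
      using ex_dm_entry[OF Suc.prems] by blast
    have "m \<noteq> 0" using dm_const[OF r Suc.prems] m by metis
    then have "mon_deg m \<noteq> 0" by simp
    then show ?case using dm_deg[OF r Suc.prems m] Suc.IH[OF r] by linarith
qed

lemma const_vec_free_mod: "w \<in> strand i \<Longrightarrow> const_vec w \<in> free_mod n (rk F (Suc i))"
  by (auto simp: const_vec_def free_mod_def strand_def poly_ring_single) (metis not_less single_zero)

lemma strand_add: "v \<in> strand i \<Longrightarrow> w \<in> strand i \<Longrightarrow> (\<lambda>c. v c + w c) \<in> strand i"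
  unfolding strand_def by (auto, (metis add.right_neutral)+)

lemma partial_strand:
  assumes "w \<in> strand (Suc i)"
  shows "partial i s w \<in> strand i"
  unfolding strand_def
proof (intro CollectI allI impI)
  fix r assume "partial i s w r \<noteq> 0"
  then have r: "r < rk F (Suc i)" and "(\<Sum>c<rk F (Suc (Suc i)).
      Poly_Mapping.lookup (dm F (Suc (Suc i)) r c) (Poly_Mapping.single s 1) * w c) \<noteq> 0"
    by (auto simp: partial_def split: if_splits)
  then obtain c where c: "c < rk F (Suc (Suc i))"
      "Poly_Mapping.lookup (dm F (Suc (Suc i)) r c) (Poly_Mapping.single s 1) * w c \<noteq> 0"
    by (meson lessThan_iff sum.not_neutral_contains_not_neutral)
  then have "sh F (Suc (Suc i)) c = i + 3" using assms by (auto simp: strand_def)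
  then show "r < rk F (Suc i) \<and> sh F (Suc i) r = i + 2"
    using dm_deg[OF r c(1), of "Poly_Mapping.single s 1"] c(2) r by simp
qed

lemma lookup_times_const: "Poly_Mapping.lookup ((p :: 'k mpoly) * Poly_Mapping.single 0 a) m = Poly_Mapping.lookup p m * (a :: 'k)"
  unfolding mult.commute[of p] lookup_single_times by simp

lemma lookup_D_const_vec:
  "r < rk F i \<Longrightarrow> Poly_Mapping.lookup (D i (const_vec w) r) m =
     (\<Sum>c<rk F (Suc i). Poly_Mapping.lookup (dm F (Suc i) r c) m * w c)"
  by (simp add: D_def mat_app_def const_vec_def lookup_sum lookup_times_const)

lemma lookup_var_sum:
  "Poly_Mapping.lookup (\<Sum>s\<in>{1..n}. var_poly s * Poly_Mapping.single 0 (g s)) m =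
    (\<Sum>s\<in>{1..n}. if m = Poly_Mapping.single s 1 then g s else (0::'k))"
  unfolding lookup_sum mult_single by (intro sum.cong) (auto simp: lookup_single when_def)

lemma lookup_var_sum_single:
  assumes "t \<in> {1..n}"
  shows "Poly_Mapping.lookup (\<Sum>s\<in>{1..n}. var_poly s * Poly_Mapping.single 0 (g s)) (Poly_Mapping.single t 1) = (g t :: 'k)"
proof -
  have "Poly_Mapping.single t (1::nat) = Poly_Mapping.single s 1 \<longleftrightarrow> s = t" for s
    by (metis keys_single singleton_inject zero_neq_one)
  then show ?thesis unfolding lookup_var_sum using assms by simp
qed

text \<open>By minimality and \<open>sh_bound\<close>, the differential is linear on the strand.\<close>

lemma D_const_vec:
  assumes w: "w \<in> strand (Suc i)"
  shows "D (Suc i) (const_vec w) = (\<lambda>r. \<Sum>s\<in>{1..n}. var_poly s * const_vec (partial i s w) r)"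
proof (rule ext, rule poly_mapping_eqI)
  fix r m
  show "Poly_Mapping.lookup (D (Suc i) (const_vec w) r) m =
      Poly_Mapping.lookup (\<Sum>s\<in>{1..n}. var_poly s * const_vec (partial i s w) r) m"
  proof (cases "r < rk F (Suc i)")
    case r: True
    show ?thesis
    proof (cases "\<exists>t\<in>{1..n}. m = Poly_Mapping.single t 1")
      case True
      then obtain t where t: "t \<in> {1..n}" "m = Poly_Mapping.single t 1" by blast
      show ?thesis
        unfolding t(2) const_vec_def[of "partial i _ w"] lookup_var_sum_single[OF t(1)] lookup_D_const_vec[OF r]
        using r by (simp add: partial_def)
    next
      case False
      have "Poly_Mapping.lookup (dm F (Suc (Suc i)) r c) m * w c = 0" if c: "c < rk F (Suc (Suc i))" for c
      proof (rule ccontr)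
        assume nz: "Poly_Mapping.lookup (dm F (Suc (Suc i)) r c) m * w c \<noteq> 0"
        then have lk: "Poly_Mapping.lookup (dm F (Suc (Suc i)) r c) m \<noteq> 0" by auto
        have "sh F (Suc (Suc i)) c = i + 3" using nz w by (auto simp: strand_def)
        then have "mon_deg m \<le> 1" using dm_deg[OF r c lk] sh_bound[OF r] by linarith
        moreover have "m \<noteq> 0" using lk dm_const[OF r c] by metis
        ultimately have "mon_deg m = 1" by (metis One_nat_def Suc_leI le_antisym mon_deg_eq_0_iff neq0_conv)
        then obtain t where t: "m = Poly_Mapping.single t 1" by (rule mon_deg_1)
        moreover have "t \<in> {1..n}"
          using dm_poly[OF r c] lk t by (auto simp: poly_ring_iff)
        ultimately show False using False by blast
      qed
      then have "Poly_Mapping.lookup (D (Suc i) (const_vec w) r) m = 0"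
        unfolding lookup_D_const_vec[OF r] by (intro sum.neutral) blast
      moreover have "Poly_Mapping.lookup (\<Sum>s\<in>{1..n}. var_poly s * const_vec (partial i s w) r) m = 0"
        unfolding const_vec_def[of "partial i _ w"] lookup_var_sum using False by (intro sum.neutral) auto
      ultimately show ?thesis by simp
    qed
  next
    case False
    then show ?thesis by (simp add: D_def mat_app_def partial_def const_vec_def)
  qed
qed

lemma D_var_sum: "D i (\<lambda>r. \<Sum>s\<in>S. var_poly s * v s r) = (\<lambda>q. \<Sum>s\<in>S. var_poly s * D i (v s) q)"
proof
  fix q
  have "(\<Sum>c<rk F (Suc i). dm F (Suc i) q c * (\<Sum>s\<in>S. var_poly s * v s c)) =
      (\<Sum>c<rk F (Suc i). \<Sum>s\<in>S. var_poly s * (dm F (Suc i) q c * v s c))"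
    by (simp add: sum_distrib_left mult.left_commute)
  also have "\<dots> = (\<Sum>s\<in>S. var_poly s * (\<Sum>c<rk F (Suc i). dm F (Suc i) q c * v s c))"
    by (subst sum.swap) (simp add: sum_distrib_left)
  finally show "D i (\<lambda>r. \<Sum>s\<in>S. var_poly s * v s r) q = (\<Sum>s\<in>S. var_poly s * D i (v s) q)"
    by (simp add: D_def mat_app_def)
qed

lemma D_D: "u \<in> free_mod n (rk F (Suc (Suc i))) \<Longrightarrow> D i (D (Suc i) u) = (\<lambda>_. 0)"
proof -
  assume u: "u \<in> free_mod n (rk F (Suc (Suc i)))"
  have "D (Suc i) u \<in> free_mod n (rk F (Suc i))"
    unfolding D_def by (rule mat_app_free_mod[OF dm_poly u])
  then show ?thesis using D_exact u by blast
qed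

lemma const_vec_eq_0:
  assumes "w \<in> strand i" "D i (const_vec w) = (\<lambda>_. 0)"
  shows "w = (\<lambda>_. 0)"
proof
  fix c
  have "Poly_Mapping.lookup (const_vec w c) 0 = 0"
    using kernel_const[OF const_vec_free_mod[OF assms(1)] assms(2)] .
  then show "w c = 0" by (simp add: const_vec_def)
qed

lemma partial_inj:
  assumes "w \<in> strand (Suc i)" "\<And>s. s \<in> {1..n} \<Longrightarrow> partial i s w = (\<lambda>_. 0)"
  shows "w = (\<lambda>_. 0)"
proof (rule const_vec_eq_0[OF assms(1)])
  show "D (Suc i) (const_vec w) = (\<lambda>_. 0)"
    unfolding D_const_vec[OF assms(1)] using assms(2) by (simp add: const_vec_def)
qed

text \<open>Brings the differential into the shape of \<open>quadratic_form_eq_0_iff\<close>, so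
  that its vanishing becomes antisymmetry in s and t.\<close>

lemma sum_partial_partial:
  assumes "\<And>s. s \<in> {1..n} \<Longrightarrow> ws s \<in> strand (Suc i)"
  shows "D (Suc i) (\<lambda>r. \<Sum>s\<in>{1..n}. var_poly s * const_vec (ws s) r) =
    (\<lambda>q. \<Sum>s\<in>{1..n}. \<Sum>t\<in>{1..n}. var_poly s * (var_poly t * Poly_Mapping.single 0 (partial i t (ws s) q)))"
  unfolding D_var_sum
proof (rule ext, rule sum.cong[OF refl])
  fix q s assume "s \<in> {1..n}"
  then show "var_poly s * D (Suc i) (const_vec (ws s)) q =
      (\<Sum>t\<in>{1..n}. var_poly s * (var_poly t * Poly_Mapping.single 0 (partial i t (ws s) q)))"
    using D_const_vec[OF assms] by (simp add: sum_distrib_left const_vec_def)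
qed

text \<open>Compare the coefficients of x_s x_t in D o D = 0.\<close>

lemma partial_anticommute:
  assumes w: "w \<in> strand (Suc (Suc i))" and st: "s \<in> {1..n}" "t \<in> {1..n}"
  shows "partial i t (partial (Suc i) s w) q = - partial i s (partial (Suc i) t w) q"
proof -
  have "D (Suc i) (\<lambda>r. \<Sum>s\<in>{1..n}. var_poly s * const_vec (partial (Suc i) s w) r) = (\<lambda>_. 0)"
    using D_D[OF const_vec_free_mod[OF w]] unfolding D_const_vec[OF w] .
  then have "(\<Sum>s\<in>{1..n}. \<Sum>t\<in>{1..n}. var_poly s * (var_poly t *
      Poly_Mapping.single 0 (partial i t (partial (Suc i) s w) q))) = 0"
    unfolding sum_partial_partial[OF partial_strand[OF w]] by meson
  then show ?thesis
    unfolding quadratic_form_eq_0_iff[OF finite_atLeastAtMost] using st by blast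
qed

text \<open>Exactness yields some preimage \<open>u\<close> with polynomial entries. As the matrix
  has no constant terms, a linear coefficient of the product sees only the constant terms of
  \<open>u\<close>, and these form the required strand element.\<close>

lemma strand_lift:
  assumes ws: "\<And>s. s \<in> {1..n} \<Longrightarrow> ws s \<in> strand i"
    and "D i (\<lambda>r. \<Sum>s\<in>{1..n}. var_poly s * const_vec (ws s) r) = (\<lambda>_. 0)"
  shows "\<exists>w\<in>strand (Suc i). \<forall>s\<in>{1..n}. partial i s w = ws s"
proof -
  let ?v = "\<lambda>r. \<Sum>s\<in>{1..n}. var_poly s * const_vec (ws s) r"
  have "?v \<in> free_mod n (rk F (Suc i))"
    unfolding free_mod_def
  proof (intro CollectI conjI allI impI)
    fix c
    have "var_poly s * const_vec (ws s) c \<in> poly_ring n" if "s \<in> {1..n}" for s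
      using that by (intro poly_ring_mult) (auto simp: const_vec_def intro!: poly_ring_single)
    then show "?v c \<in> poly_ring n" by (rule poly_ring_sum)
  next
    fix c assume "rk F (Suc i) \<le> c"
    then have "const_vec (ws s) c = 0" if "s \<in> {1..n}" for s
      using const_vec_free_mod[OF ws[OF that]] by (simp add: free_mod_def)
    then show "?v c = 0" by simp
  qed
  then obtain u where u: "?v = D (Suc i) u"
    using D_exact assms(2) by blast
  \<comment> \<open>A linear entry into a basis element of degree i + 2 must come from one of degree
    i + 3, so the other constants of \<open>u\<close> can be discarded.\<close>
  define w where "w c = (if c < rk F (Suc (Suc i)) \<and> sh F (Suc (Suc i)) c = i + 3
    then Poly_Mapping.lookup (u c) 0 else 0)" for c
  have w: "w \<in> strand (Suc i)" by (simp add: strand_def w_def)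
  have "partial i s w r = ws s r" if s: "s \<in> {1..n}" for s r
  proof (cases "r < rk F (Suc i) \<and> sh F (Suc i) r = i + 2")
    case True
    then have r: "r < rk F (Suc i)" by blast
    let ?s = "Poly_Mapping.single s (1::nat)"
    have "ws s r = Poly_Mapping.lookup (?v r) ?s"
      unfolding const_vec_def lookup_var_sum_single[OF s] ..
    also have "\<dots> = (\<Sum>c<rk F (Suc (Suc i)). Poly_Mapping.lookup (dm F (Suc (Suc i)) r c * u c) ?s)"
    proof -
      have "?v r = (\<Sum>c<rk F (Suc (Suc i)). dm F (Suc (Suc i)) r c * u c)"
        using fun_cong[OF u, of r] r by (simp add: D_def mat_app_def)
      then show ?thesis by (subst \<open>?v r = _\<close>) (rule lookup_sum)
    qed
    also have "\<dots> = (\<Sum>c<rk F (Suc (Suc i)). Poly_Mapping.lookup (dm F (Suc (Suc i)) r c) ?s * w c)"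
    proof (intro sum.cong refl)
      fix c assume "c \<in> {..<rk F (Suc (Suc i))}"
      then have c: "c < rk F (Suc (Suc i))" by simp
      have "Poly_Mapping.lookup (dm F (Suc (Suc i)) r c * u c) ?s =
          Poly_Mapping.lookup (dm F (Suc (Suc i)) r c) ?s * Poly_Mapping.lookup (u c) 0"
      proof (rule lookup_times_leading)
        fix a assume a: "Poly_Mapping.lookup (dm F (Suc (Suc i)) r c) a \<noteq> 0" "mon_le a ?s"
        then have "a \<noteq> 0" using dm_const[OF r c] by metis
        then have "mon_deg ?s \<le> mon_deg a" by (simp add: Suc_leI neq0_conv[symmetric])
        then show "a = ?s" using a(2) by (intro mon_le_mon_deg_eq)
      qed
      also have "\<dots> = Poly_Mapping.lookup (dm F (Suc (Suc i)) r c) ?s * w c"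
        using dm_deg[OF r c, of ?s] True c
          by (cases "Poly_Mapping.lookup (dm F (Suc (Suc i)) r c) ?s = 0") (simp_all add: w_def)
      finally show "Poly_Mapping.lookup (dm F (Suc (Suc i)) r c * u c) ?s =
        Poly_Mapping.lookup (dm F (Suc (Suc i)) r c) ?s * w c" .
    qed
    finally show ?thesis using r by (simp add: partial_def)
  next
    case False
    then show ?thesis using ws[OF s] partial_strand[OF w, of s] unfolding strand_def
      by (metis (mono_tags, lifting) mem_Collect_eq)
  qed
  then show ?thesis using w by blast
qed

section \<open>The strand in homological degree one and the quadrics of the ideal\<close>

lemma augment_ideal: "w \<in> strand 0 \<Longrightarrow> augment w \<in> nonface_ideal n \<Gamma>"
proof -
  assume w: "w \<in> strand 0"
  have "(\<lambda>r. if r = 0 then augment w else 0) = D 0 (const_vec w)"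
    by (auto simp: augment_def D_def mat_app_def rk_0)
  then show ?thesis using ideal_iff const_vec_free_mod[OF w] by auto
qed

lemma augment_deg:
  assumes "w \<in> strand 0" "Poly_Mapping.lookup (augment w) m \<noteq> 0"
  shows "mon_deg m = 2"
proof -
  have r: "0 < rk F 0" by (simp add: rk_0)
  have "(\<Sum>c<rk F (Suc 0). Poly_Mapping.lookup (dm F (Suc 0) 0 c) m * w c) \<noteq> 0"
    using assms(2) unfolding augment_def lookup_D_const_vec[OF r] .
  then obtain c where c: "c < rk F (Suc 0)" "Poly_Mapping.lookup (dm F (Suc 0) 0 c) m * w c \<noteq> 0"
    by (meson lessThan_iff sum.not_neutral_contains_not_neutral)
  then have "sh F (Suc 0) c = 2" using assms(1) by (auto simp: strand_def)
  then show ?thesis using dm_deg[OF r c(1), of m] c(2) sh_0 by simp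
qed

lemma augment_inj:
  assumes "w \<in> strand 0" "augment w = 0"
  shows "w = (\<lambda>_. 0)"
proof (rule const_vec_eq_0[OF assms(1)])
  show "D 0 (const_vec w) = (\<lambda>_. 0)"
  proof
    fix r show "D 0 (const_vec w) r = 0"
      using assms(2) by (cases r) (auto simp: augment_def D_def mat_app_def rk_0)
  qed
qed

text \<open>As in \<open>strand_lift\<close>, the constant part of a preimage suffices: by
  \<open>sh_bound\<close> the entries of the first matrix have no terms of degree below 2, so a
  quadratic coefficient sees only constants.\<close>

lemma augment_surj:
  assumes p: "p \<in> nonface_ideal n \<Gamma>" "\<And>m. Poly_Mapping.lookup p m \<noteq> 0 \<Longrightarrow> mon_deg m = 2"
  obtains w where "w \<in> strand 0" "augment w = p"
proof -
  obtain u where u: "(\<lambda>r. if r = 0 then p else 0) = D 0 u" using p(1) ideal_iff by blast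
  define w where "w c = (if c < rk F (Suc 0) \<and> sh F (Suc 0) c = 2 then Poly_Mapping.lookup (u c) 0 else 0)" for c
  have w: "w \<in> strand 0" by (simp add: strand_def w_def)
  have r: "0 < rk F 0" by (simp add: rk_0)
  have "augment w = p"
  proof (rule poly_mapping_eqI)
    fix m
    show "Poly_Mapping.lookup (augment w) m = Poly_Mapping.lookup p m"
    proof (cases "mon_deg m = 2")
      case True
      have "p = D 0 u 0" using fun_cong[OF u, of 0] by simp
      then have "Poly_Mapping.lookup p m = (\<Sum>c<rk F (Suc 0). Poly_Mapping.lookup (dm F (Suc 0) 0 c * u c) m)"
        using r by (simp add: D_def mat_app_def lookup_sum)
      also have "\<dots> = (\<Sum>c<rk F (Suc 0). Poly_Mapping.lookup (dm F (Suc 0) 0 c) m * w c)"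
      proof (intro sum.cong refl)
        fix c assume "c \<in> {..<rk F (Suc 0)}"
        then have c: "c < rk F (Suc 0)" by simp
        have "Poly_Mapping.lookup (dm F (Suc 0) 0 c * u c) m =
            Poly_Mapping.lookup (dm F (Suc 0) 0 c) m * Poly_Mapping.lookup (u c) 0"
        proof (rule lookup_times_leading)
          fix a assume a: "Poly_Mapping.lookup (dm F (Suc 0) 0 c) a \<noteq> 0" "mon_le a m"
          have "2 \<le> mon_deg a" using dm_deg[OF r c a(1)] sh_bound[OF c] sh_0 by simp
          then show "a = m" using a(2) True by (intro mon_le_mon_deg_eq) simp_all
        qed
        also have "\<dots> = Poly_Mapping.lookup (dm F (Suc 0) 0 c) m * w c"
          using dm_deg[OF r c, of m] True c sh_0 by (auto simp: w_def)
        finally show "Poly_Mapping.lookup (dm F (Suc 0) 0 c * u c) m =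
          Poly_Mapping.lookup (dm F (Suc 0) 0 c) m * w c" .
      qed
      finally show ?thesis unfolding augment_def lookup_D_const_vec[OF r] ..
    next
      case False
      then show ?thesis using p(2) augment_deg[OF w] by metis
    qed
  qed
  then show ?thesis using that w by blast
qed

end

section \<open>Identification of the strand with the Koszul cycles\<close>

context flag_resolution
begin

text \<open>The number \<open>i\<close> is the strand index of \<open>w\<close> and drops with each
  list entry; on lists of length \<open>i\<close> the recursion arrives at \<open>augment\<close>
  exactly on \<open>strand 0\<close>.\<close>

primrec iterate_partial :: "nat list \<Rightarrow> nat \<Rightarrow> (nat \<Rightarrow> 'k) \<Rightarrow> 'k mpoly" where
  "iterate_partial [] i w = augment w"
| "iterate_partial (s # l) i w = iterate_partial l (i - 1) (partial (i - 1) s w)"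

lemma augment_add: "augment (\<lambda>c. v c + w c) = augment v + augment w"
  by (simp add: augment_def D_def mat_app_def const_vec_def single_add distrib_left sum.distrib)

lemma augment_uminus: "augment (\<lambda>c. - w c) = - augment w"
  by (simp add: augment_def D_def mat_app_def const_vec_def single_uminus sum_negf)

lemma partial_add: "partial i s (\<lambda>c. v c + w c) = (\<lambda>c. partial i s v c + partial i s w c)"
  by (auto simp: partial_def distrib_left sum.distrib)

lemma partial_uminus: "partial i s (\<lambda>c. - w c) = (\<lambda>c. - partial i s w c)"
  by (auto simp: partial_def sum_negf)

lemma iterate_partial_add:
  "iterate_partial l i (\<lambda>c. v c + w c) = iterate_partial l i v + iterate_partial l i w"
  by (induction l arbitrary: i v w) (simp_all add: augment_add partial_add)

lemma iterate_partial_uminus: "iterate_partial l i (\<lambda>c. - w c) = - iterate_partial l i w"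
  by (induction l arbitrary: i w) (simp_all add: augment_uminus partial_uminus)

text \<open>After the common prefix is peeled off, alternation is
  \<open>partial_anticommute\<close>, and the cycle condition is D o D = 0 at the end of the
  resolution, from module 2 to R.\<close>

lemma koszul_cycle_iterate_partial:
  assumes "w \<in> strand i"
  shows "koszul_cycle n \<Gamma> i (\<lambda>l. iterate_partial l i w)"
  unfolding koszul_cycle_def
proof (intro conjI allI impI; elim conjE)
  fix l assume "length l = i" "set l \<subseteq> {1..n}"
  then have "iterate_partial l i w \<in> nonface_ideal n \<Gamma> \<and>
      (\<forall>m. Poly_Mapping.lookup (iterate_partial l i w) m \<noteq> 0 \<longrightarrow> mon_deg m = 2)"
    using assms
  proof (induction l arbitrary: i w)
    case Nil
    then show ?case using augment_ideal augment_deg by auto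
  next
    case (Cons s l)
    then show ?case using partial_strand[of w "length l" s] by auto
  qed
  then show "iterate_partial l i w \<in> nonface_ideal n \<Gamma>"
    "Poly_Mapping.lookup (iterate_partial l i w) m \<noteq> 0 \<Longrightarrow> mon_deg m = 2" for m by blast+
next
  fix xs a b ys assume "length (xs @ a # b # ys) = i" "set (xs @ a # b # ys) \<subseteq> {1..n}"
  then show "iterate_partial (xs @ a # b # ys) i w = - iterate_partial (xs @ b # a # ys) i w"
    using assms
  proof (induction xs arbitrary: i w)
    case Nil
    then obtain k where k: "i = Suc (Suc k)" "a \<in> {1..n}" "b \<in> {1..n}" by auto
    have "partial k b (partial (Suc k) a w) = (\<lambda>q. - partial k a (partial (Suc k) b w) q)"
      using partial_anticommute[of w k a b] Nil.prems(3) k by auto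
    then show ?case by (simp add: k iterate_partial_uminus)
  next
    case (Cons s xs)
    obtain k where k: "i = Suc k" using Cons.prems(1) by auto
    then show ?case using Cons partial_strand[of w k s] by simp
  qed
next
  fix l assume "Suc (length l) = i" "set l \<subseteq> {1..n}"
  then show "(\<Sum>s\<in>{1..n}. var_poly s * iterate_partial (l @ [s]) i w) = 0"
    using assms
  proof (induction l arbitrary: i w)
    case Nil
    then have w: "w \<in> strand (Suc 0)" by simp
    have "D 0 (\<lambda>r. \<Sum>s\<in>{1..n}. var_poly s * const_vec (partial 0 s w) r) 0 = 0"
      using D_D[OF const_vec_free_mod[OF w]] unfolding D_const_vec[OF w] by metis
    then show ?case using Nil.prems(1) unfolding D_var_sum by (simp add: augment_def)
  next
    case (Cons t l)
    then show ?case using partial_strand[of w "Suc (length l)" t] by auto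
  qed
qed

lemma iterate_partial_inj:
  assumes "w \<in> strand i" "\<And>l. length l = i \<Longrightarrow> set l \<subseteq> {1..n} \<Longrightarrow> iterate_partial l i w = 0"
  shows "w = (\<lambda>_. 0)"
  using assms
proof (induction i arbitrary: w)
  case 0
  then show ?case using augment_inj[of w] 0(2)[of "[]"] by simp
next
  case (Suc i)
  show ?case
  proof (rule partial_inj[OF Suc.prems(1)])
    fix s assume s: "s \<in> {1..n}"
    show "partial i s w = (\<lambda>_. 0)"
    proof (rule Suc.IH[OF partial_strand[OF Suc.prems(1)]])
      fix l assume "length l = i" "set l \<subseteq> {1..n}"
      then show "iterate_partial l i (partial i s w) = 0" using Suc.prems(2)[of "s # l"] s by simp
    qed
  qed
qed

text \<open>By induction, fixing the first index s gives strand elements \<open>ws s\<close>. To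
  glue them with \<open>strand_lift\<close>, the sum of x_s \<open>ws s\<close> must be killed by D:
  for one index this is the cycle condition itself, and for more it follows from alternation in the
  first two indices, transferred to the strand by \<open>iterate_partial_inj\<close>.\<close>

lemma koszul_cycle_lift:
  assumes "koszul_cycle n \<Gamma> i f"
  shows "\<exists>w\<in>strand i. \<forall>l. length l = i \<and> set l \<subseteq> {1..n} \<longrightarrow> iterate_partial l i w = f l"
  using assms
proof (induction i arbitrary: f)
  case 0
  then have "f [] \<in> nonface_ideal n \<Gamma>" "\<And>m. Poly_Mapping.lookup (f []) m \<noteq> 0 \<Longrightarrow> mon_deg m = 2"
    unfolding koszul_cycle_def by auto
  then obtain w where "w \<in> strand 0" "augment w = f []" by (rule augment_surj)
  then show ?case by auto
next
  case (Suc i)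
  have "\<forall>s\<in>{1..n}. \<exists>w\<in>strand i. \<forall>l. length l = i \<and> set l \<subseteq> {1..n} \<longrightarrow> iterate_partial l i w = f (s # l)"
    using Suc.IH koszul_cycle_Cons[OF Suc.prems] by blast
  then obtain ws where ws: "\<And>s. s \<in> {1..n} \<Longrightarrow> ws s \<in> strand i"
    and fs: "\<And>s l. s \<in> {1..n} \<Longrightarrow> length l = i \<Longrightarrow> set l \<subseteq> {1..n} \<Longrightarrow> iterate_partial l i (ws s) = f (s # l)"
    by metis
  have "D i (\<lambda>r. \<Sum>s\<in>{1..n}. var_poly s * const_vec (ws s) r) = (\<lambda>_. 0)"
  proof (cases i)
    case 0
    have "(\<Sum>s\<in>{1..n}. var_poly s * f ([] @ [s])) = 0"
      using Suc.prems 0 unfolding koszul_cycle_def by simp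
    moreover have "augment (ws s) = f ([] @ [s])" if "s \<in> {1..n}" for s
      using fs[OF that, of "[]"] 0 by simp
    ultimately have "(\<Sum>s\<in>{1..n}. var_poly s * augment (ws s)) = 0" by simp
    then have "(\<Sum>s\<in>{1..n}. var_poly s * D 0 (const_vec (ws s)) q) = 0" for q
      by (cases q) (simp_all add: augment_def D_def mat_app_def rk_0)
    then show ?thesis unfolding 0 D_var_sum by blast
  next
    case (Suc k)
    have "partial k t (ws s) q = - partial k s (ws t) q" if st: "s \<in> {1..n}" "t \<in> {1..n}" for s t q
    proof -
      have mem: "partial k t (ws s) \<in> strand k" "partial k s (ws t) \<in> strand k"
        using partial_strand ws st Suc by blast+
      have "(\<lambda>c. partial k t (ws s) c + partial k s (ws t) c) = (\<lambda>_. 0)"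
      proof (rule iterate_partial_inj[OF strand_add[OF mem]])
        fix l assume l: "length l = k" "set l \<subseteq> {1..n}"
        have "iterate_partial l k (partial k t (ws s)) = f (s # t # l)"
          "iterate_partial l k (partial k s (ws t)) = f (t # s # l)"
          using fs[OF st(1), of "t # l"] fs[OF st(2), of "s # l"] st l Suc by simp_all
        moreover have "f ([] @ s # t # l) = - f ([] @ t # s # l)"
        proof -
          have "length ([] @ s # t # l) = Suc i \<and> set ([] @ s # t # l) \<subseteq> {1..n}"
            using st l Suc by simp
          then show ?thesis using Suc.prems unfolding koszul_cycle_def by blast
        qed
        ultimately show "iterate_partial l k (\<lambda>c. partial k t (ws s) c + partial k s (ws t) c) = 0"
          by (simp add: iterate_partial_add)
      qed
      then show ?thesis by (metis eq_neg_iff_add_eq_0)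
    qed
    then have "(\<Sum>s\<in>{1..n}. \<Sum>t\<in>{1..n}. var_poly s * (var_poly t *
        Poly_Mapping.single 0 (partial k t (ws s) q))) = 0" for q
      unfolding quadratic_form_eq_0_iff[OF finite_atLeastAtMost] by blast
    moreover have "\<And>s. s \<in> {1..n} \<Longrightarrow> ws s \<in> strand (Suc k)" using ws Suc by simp
    ultimately show ?thesis unfolding Suc using sum_partial_partial by simp
  qed
  with ws have "\<exists>w\<in>strand (Suc i). \<forall>s\<in>{1..n}. partial i s w = ws s"
    by (rule strand_lift)
  then obtain w where w: "w \<in> strand (Suc i)" "\<And>s. s \<in> {1..n} \<Longrightarrow> partial i s w = ws s"
    by blast
  have "iterate_partial l (Suc i) w = f l" if "length l = Suc i \<and> set l \<subseteq> {1..n}" for l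
    using that w(2) fs by (cases l) auto
  then show ?case using w(1) by blast
qed

lemma linear_strand_nonzero_iff:
  "card {c. c < rk F (Suc i) \<and> sh F (Suc i) c = i + 2} \<noteq> 0 \<longleftrightarrow>
    (\<exists>f :: nat list \<Rightarrow> 'k mpoly. koszul_cycle n \<Gamma> i f \<and> (\<exists>l. length l = i \<and> set l \<subseteq> {1..n} \<and> f l \<noteq> 0))"
    (is "?l \<longleftrightarrow> ?r")
proof -
  have "?l \<longleftrightarrow> (\<exists>w\<in>strand i. w \<noteq> (\<lambda>_. 0))"
  proof
    assume ?l
    then obtain c where c: "c < rk F (Suc i)" "sh F (Suc i) c = i + 2"
      by (metis (mono_tags, lifting) card.empty Collect_empty_eq)
    then have "(\<lambda>c'. if c' = c then 1 else 0) \<in> strand i" by (simp add: strand_def)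
    moreover have "(\<lambda>c'. if c' = c then 1 else 0) \<noteq> (\<lambda>_. 0 :: 'k)" by (metis zero_neq_one)
    ultimately show "\<exists>w\<in>strand i. w \<noteq> (\<lambda>_. 0)" by blast
  next
    assume "\<exists>w\<in>strand i. w \<noteq> (\<lambda>_. 0)"
    then obtain w c where "w \<in> strand i" "w c \<noteq> 0" by blast
    then have "c \<in> {c. c < rk F (Suc i) \<and> sh F (Suc i) c = i + 2}" by (simp add: strand_def)
    then have "{c. c < rk F (Suc i) \<and> sh F (Suc i) c = i + 2} \<noteq> {}" by blast
    then show ?l by simp
  qed
  also have "\<dots> \<longleftrightarrow> ?r"
  proof
    assume "\<exists>w\<in>strand i. w \<noteq> (\<lambda>_. 0)"
    then obtain w where w: "w \<in> strand i" "w \<noteq> (\<lambda>_. 0)" by blast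
    then obtain l where "length l = i" "set l \<subseteq> {1..n}" "iterate_partial l i w \<noteq> 0"
      using iterate_partial_inj by blast
    then show ?r using koszul_cycle_iterate_partial[OF w(1)] by blast
  next
    assume ?r
    then obtain f :: "nat list \<Rightarrow> 'k mpoly" and l where f: "koszul_cycle n \<Gamma> i f"
      and l: "length l = i" "set l \<subseteq> {1..n}" "f l \<noteq> 0" by blast
    obtain w where w: "w \<in> strand i" "\<And>l. length l = i \<and> set l \<subseteq> {1..n} \<Longrightarrow> iterate_partial l i w = f l"
      using koszul_cycle_lift[OF f] by blast
    have "augment (\<lambda>_. 0) = 0" by (simp add: augment_def D_def mat_app_def const_vec_def)
    moreover have "partial i s (\<lambda>_. 0) = (\<lambda>_. 0)" for i s by (auto simp: partial_def)
    ultimately have "iterate_partial l i (\<lambda>_. 0) = 0" for l i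
      by (induction l arbitrary: i) simp_all
    then show "\<exists>w\<in>strand i. w \<noteq> (\<lambda>_. 0)" using w l by metis
  qed
  finally show ?thesis .
qed

end

subsection \<open>Koszul cycles and disconnected vertex sets\<close>

abbreviation edge_mon :: "nat \<Rightarrow> nat \<Rightarrow> (nat \<Rightarrow>\<^sub>0 nat)" where
  "edge_mon u v \<equiv> Poly_Mapping.single u 1 + Poly_Mapping.single v 1"

lemma keys_edge_mon: "Poly_Mapping.keys (edge_mon u v) = {u, v}"
  unfolding keys_add_mon by auto

text \<open>A support that is not a clique contains a nonadjacent pair, and its product divides
  \<open>m\<close> and already has full degree 2. In particular squares of variables never
  occur.\<close>

lemma nonface_quadratic_coeff:
  assumes E: "graph_on n E" and p: "p \<in> nonface_ideal n (clique_complex n E)"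
    and deg: "\<And>m. Poly_Mapping.lookup p m \<noteq> 0 \<Longrightarrow> mon_deg m = 2" and m: "Poly_Mapping.lookup p m \<noteq> 0"
  obtains u v where "u \<in> {1..n}" "v \<in> {1..n}" "u \<noteq> v" "\<not> E u v" "m = edge_mon u v"
proof -
  have "Poly_Mapping.keys m \<subseteq> {1..n}" "Poly_Mapping.keys m \<notin> clique_complex n E"
    using p m by (auto simp: nonface_ideal_def poly_ring_iff in_keys_iff)
  then obtain u v where uv: "u \<in> Poly_Mapping.keys m" "v \<in> Poly_Mapping.keys m" "u \<noteq> v" "\<not> E u v"
    by (auto simp: clique_complex_def)
  have "mon_le (edge_mon u v) m"
    unfolding mon_le_def
  proof
    fix i show "Poly_Mapping.lookup (edge_mon u v) i \<le> Poly_Mapping.lookup m i"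
      using uv by (cases "i = u"; cases "i = v") (auto simp: lookup_add lookup_single in_keys_iff)
  qed
  then have "edge_mon u v = m"
    using deg[OF m] by (intro mon_le_mon_deg_eq) (simp_all add: mon_deg_add)
  then show ?thesis using that uv \<open>Poly_Mapping.keys m \<subseteq> {1..n}\<close> by blast
qed

lemma nonface_edge_coeff:
  assumes "graph_on n E" "p \<in> nonface_ideal n (clique_complex n E)"
    "\<And>m. Poly_Mapping.lookup p m \<noteq> 0 \<Longrightarrow> mon_deg m = 2" "Poly_Mapping.lookup p (edge_mon a b) \<noteq> 0"
  shows "a \<noteq> b \<and> \<not> E a b \<and> \<not> E b a"
proof -
  obtain u v where uv: "u \<noteq> v" "\<not> E u v" "edge_mon a b = edge_mon u v"
    using nonface_quadratic_coeff[OF assms(1,2,3,4)] by metis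
  moreover have "\<not> E v u" using assms(1) uv(2) by (auto simp: graph_on_def)
  ultimately show ?thesis unfolding single_add_single_eq_iff by blast
qed

locale clique_koszul_cycle =
  fixes n :: nat and E :: "nat \<Rightarrow> nat \<Rightarrow> bool" and i :: nat and f :: "nat list \<Rightarrow> ('k::field_char_0) mpoly"
  assumes E: "graph_on n E" and f: "koszul_cycle n (clique_complex n E) i f"
begin

definition valid :: "nat list \<Rightarrow> bool" where
  "valid l \<longleftrightarrow> length l = i \<and> set l \<subseteq> {1..n}"

lemma coeff_swap:
  assumes "valid (xs @ a # b # ys)"
  shows "Poly_Mapping.lookup (f (xs @ a # b # ys)) m = - Poly_Mapping.lookup (f (xs @ b # a # ys)) m"
proof -
  have "f (xs @ a # b # ys) = - f (xs @ b # a # ys)"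
    using f assms unfolding koszul_cycle_def valid_def by blast
  then show ?thesis by simp
qed

lemma coeff_move:
  assumes "valid (xs @ a # ys @ zs)" "Poly_Mapping.lookup (f (xs @ a # ys @ zs)) m \<noteq> 0"
  shows "Poly_Mapping.lookup (f (xs @ ys @ a # zs)) m \<noteq> 0"
  using assms
proof (induction ys arbitrary: xs)
  case (Cons y ys)
  have "valid ((xs @ [y]) @ a # ys @ zs)" using Cons.prems(1) by (auto simp: valid_def)
  moreover have "Poly_Mapping.lookup (f ((xs @ [y]) @ a # ys @ zs)) m \<noteq> 0"
    using coeff_swap[of xs a y "ys @ zs" m] Cons.prems by simp
  ultimately show ?case using Cons.IH[of "xs @ [y]"] by simp
qed simp

lemma coeff_move_end:
  assumes "valid l" "x \<in> set l" "Poly_Mapping.lookup (f l) m \<noteq> 0"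
  obtains l' where "valid (l' @ [x])" "insert x (set l') = set l" "Poly_Mapping.lookup (f (l' @ [x])) m \<noteq> 0"
proof -
  obtain xs ys where l: "l = xs @ x # ys" using assms(2) by (meson split_list)
  show ?thesis
  proof (rule that[of "xs @ ys"])
    show "Poly_Mapping.lookup (f ((xs @ ys) @ [x])) m \<noteq> 0"
      using coeff_move[of xs x ys "[]" m] assms l by simp
  qed (use assms l in \<open>auto simp: valid_def\<close>)
qed

text \<open>Once two equal indices are moved next to each other, swapping them shows that the
  coefficient is its own negative.\<close>

lemma coeff_distinct:
  assumes "valid l" "Poly_Mapping.lookup (f l) m \<noteq> 0"
  shows "distinct l"
proof (rule ccontr)
  assume "\<not> distinct l"
  then obtain xs y ys zs where l: "l = xs @ [y] @ ys @ [y] @ zs" using not_distinct_decomp by blast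
  then have "Poly_Mapping.lookup (f (xs @ ys @ y # y # zs)) m \<noteq> 0"
    using coeff_move[of xs y ys "y # zs" m] assms by simp
  moreover have "valid ((xs @ ys) @ y # y # zs)" using assms(1) l by (auto simp: valid_def)
  then have "Poly_Mapping.lookup (f (xs @ ys @ y # y # zs)) m = 0"
    using coeff_swap[of "xs @ ys" y y zs m] by simp
  ultimately show False by contradiction
qed

lemma edge_coeff:
  assumes "valid l" "Poly_Mapping.lookup (f l) (edge_mon a b) \<noteq> 0"
  shows "a \<noteq> b \<and> \<not> E a b \<and> \<not> E b a"
proof -
  have "f l \<in> nonface_ideal n (clique_complex n E)"
    "\<And>m. Poly_Mapping.lookup (f l) m \<noteq> 0 \<Longrightarrow> mon_deg m = 2"
    using f assms(1) unfolding koszul_cycle_def valid_def by blast+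
  then show ?thesis using nonface_edge_coeff[OF E] assms(2) by blast
qed

text \<open>This is the cycle condition at the monomial x_a x_b x_c. The sum runs over a set so that
  a repeated variable counts once, as needed at x_a^2 x_b.\<close>

lemma cocycle:
  assumes l: "Suc (length l) = i" "set l \<subseteq> {1..n}" and abc: "{a, b, c} \<subseteq> {1..n}"
  shows "(\<Sum>s\<in>{a, b, c}. Poly_Mapping.lookup (f (l @ [s])) (edge_mon a b + Poly_Mapping.single c 1 - Poly_Mapping.single s 1)) = 0"
proof -
  let ?m = "edge_mon a b + Poly_Mapping.single c 1"
  have le_iff: "mon_le (Poly_Mapping.single s 1) ?m \<longleftrightarrow> s \<in> {a, b, c}" for s
  proof
    assume "mon_le (Poly_Mapping.single s 1) ?m"
    then show "s \<in> {a, b, c}" using mon_le_keys[of "Poly_Mapping.single s 1" ?m]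
      unfolding keys_add_mon by auto
  next
    assume "s \<in> {a, b, c}"
    then show "mon_le (Poly_Mapping.single s 1) ?m"
      by (auto simp: mon_le_def lookup_add lookup_single when_def)
  qed
  have "(\<Sum>s\<in>{1..n}. var_poly s * f (l @ [s])) = 0"
    using f l unfolding koszul_cycle_def by blast
  then have "0 = Poly_Mapping.lookup (\<Sum>s\<in>{1..n}. var_poly s * f (l @ [s])) ?m"
    by simp
  also have "\<dots> = (\<Sum>s\<in>{1..n}. if s \<in> {a, b, c}
      then Poly_Mapping.lookup (f (l @ [s])) (?m - Poly_Mapping.single s 1) else 0)"
    unfolding lookup_sum lookup_single_times le_iff by (intro sum.cong) auto
  also have "\<dots> = (\<Sum>s\<in>{1..n} \<inter> {a, b, c}. Poly_Mapping.lookup (f (l @ [s])) (?m - Poly_Mapping.single s 1))"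
    by (rule sum.inter_restrict[symmetric]) simp
  also have "{1..n} \<inter> {a, b, c} = {a, b, c}" using abc by blast
  finally show ?thesis by simp
qed

text \<open>With a as last index, \<open>cocycle\<close> at x_a^2 x_b has two terms. The one with
  index b carries the coefficient of x_a^2, which is zero, so the other vanishes too. Hence monomial
  and index list use disjoint vertices.\<close>

lemma coeff_notin:
  assumes l: "valid l" and ab: "a \<in> {1..n}" "b \<in> {1..n}" and nz: "Poly_Mapping.lookup (f l) (edge_mon a b) \<noteq> 0"
  shows "a \<notin> set l"
proof
  assume "a \<in> set l"
  then obtain l' where l': "valid (l' @ [a])" "Poly_Mapping.lookup (f (l' @ [a])) (edge_mon a b) \<noteq> 0"
    using coeff_move_end[OF l _ nz] by metis
  have "a \<noteq> b" using edge_coeff[OF l nz] by blast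
  have "valid (l' @ [b])" using l'(1) ab by (simp add: valid_def)
  then have zero: "Poly_Mapping.lookup (f (l' @ [b])) (edge_mon a a) = 0"
    using edge_coeff by blast
  have "(\<Sum>s\<in>{a, b}. Poly_Mapping.lookup (f (l' @ [s])) (edge_mon a b + Poly_Mapping.single a 1 - Poly_Mapping.single s 1)) = 0"
    using cocycle[of l' a b a] l'(1) ab by (simp add: valid_def insert_commute)
  moreover have "edge_mon a b + Poly_Mapping.single a 1 - Poly_Mapping.single b 1 = edge_mon a a"
    by (rule poly_mapping_eqI) (simp add: lookup_add lookup_minus)
  ultimately show False using \<open>a \<noteq> b\<close> zero l'(2) by simp
qed

text \<open>Of the three terms of \<open>cocycle\<close>, the one with index a vanishes because b
  and x are adjacent; the remaining two cancel, so b and x can change places between monomial and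
  index list.\<close>

lemma coeff_step:
  assumes l: "valid (l @ [x])" and abx: "a \<in> {1..n}" "b \<in> {1..n}" "a \<noteq> b" "x \<noteq> a" "x \<noteq> b" and "E b x"
    and nz: "Poly_Mapping.lookup (f (l @ [x])) (edge_mon a b) \<noteq> 0"
  shows "Poly_Mapping.lookup (f (l @ [b])) (edge_mon a x) \<noteq> 0"
proof
  assume z: "Poly_Mapping.lookup (f (l @ [b])) (edge_mon a x) = 0"
  have "valid (l @ [a])" using l abx by (simp add: valid_def)
  then have z': "Poly_Mapping.lookup (f (l @ [a])) (edge_mon b x) = 0"
    using edge_coeff \<open>E b x\<close> by blast
  have "(\<Sum>s\<in>{a, b, x}. Poly_Mapping.lookup (f (l @ [s])) (edge_mon a b + Poly_Mapping.single x 1 - Poly_Mapping.single s 1)) = 0"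
    using cocycle[of l a b x] l abx by (simp add: valid_def)
  moreover have "edge_mon a b + Poly_Mapping.single x 1 - Poly_Mapping.single a 1 = edge_mon b x"
    by (rule poly_mapping_eqI) (simp add: lookup_add lookup_minus)
  moreover have "edge_mon a b + Poly_Mapping.single x 1 - Poly_Mapping.single b 1 = edge_mon a x"
    by (rule poly_mapping_eqI) (simp add: lookup_add lookup_minus)
  ultimately show False using z z' nz abx by simp
qed

text \<open>The nonvanishing of the coefficient at \<open>x\<^sub>a x\<^sub>b\<close> propagates from \<open>b\<close> along the edges of the induced
  subgraph on \<open>W\<close>; if \<open>W\<close> were connected it would reach \<open>x\<^sub>a\<^sup>2\<close>, which is not in the ideal.\<close>

lemma ex_disconnected:
  assumes l: "valid l" and nz: "f l \<noteq> 0"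
  shows "\<exists>W\<subseteq>{1..n}. card W = i + 2 \<and> \<not> connected_on E W"
proof -
  obtain m where m: "Poly_Mapping.lookup (f l) m \<noteq> 0" using nz by (metis lookup_zero poly_mapping_eqI)
  have fl: "f l \<in> nonface_ideal n (clique_complex n E)"
    "\<And>m. Poly_Mapping.lookup (f l) m \<noteq> 0 \<Longrightarrow> mon_deg m = 2"
    using f l unfolding koszul_cycle_def valid_def by blast+
  obtain a b where ab: "a \<in> {1..n}" "b \<in> {1..n}" "a \<noteq> b" "m = edge_mon a b"
    using nonface_quadratic_coeff[OF E fl m] by metis
  define W where "W = insert a (insert b (set l))"
  have nz: "Poly_Mapping.lookup (f l) (edge_mon a b) \<noteq> 0" using m ab(4) by simp
  then have "Poly_Mapping.lookup (f l) (edge_mon b a) \<noteq> 0" by (simp add: add.commute)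
  then have "a \<notin> set l" "b \<notin> set l" using coeff_notin[OF l] nz ab by blast+
  then have card: "card W = i + 2"
    using ab(3) coeff_distinct[OF l m] l by (simp add: W_def valid_def distinct_card)
  have W: "W \<subseteq> {1..n}" using l ab by (auto simp: W_def valid_def)
  \<comment> \<open>P v says that v can be the partner of a in the monomial, with all remaining
    vertices of the same W as indices. Every exchange along an edge preserves W.\<close>
  define P where "P v \<longleftrightarrow> (\<exists>l. valid l \<and> insert a (insert v (set l)) = W \<and>
    Poly_Mapping.lookup (f l) (edge_mon a v) \<noteq> 0)" for v
  have step: "P y" if Px: "P x" and xy: "x \<in> W \<and> y \<in> W \<and> E x y" for x y
  proof -
    obtain l where l: "valid l" "insert a (insert x (set l)) = W" "Poly_Mapping.lookup (f l) (edge_mon a x) \<noteq> 0"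
      using Px unfolding P_def by blast
    have ax: "a \<noteq> x" "\<not> E x a" using edge_coeff[OF l(1,3)] by blast+
    then have ya: "y \<noteq> a" using xy by blast
    have yx: "y \<noteq> x" using xy E by (auto simp: graph_on_def)
    then have "y \<in> set l" using l(2) xy ya by blast
    then obtain l' where l': "valid (l' @ [y])" "insert y (set l') = set l"
      "Poly_Mapping.lookup (f (l' @ [y])) (edge_mon a x) \<noteq> 0"
      using coeff_move_end[OF l(1) _ l(3)] by metis
    have "x \<in> {1..n}" using xy W by blast
    then have "Poly_Mapping.lookup (f (l' @ [x])) (edge_mon a y) \<noteq> 0"
      using coeff_step[OF l'(1), of a x] ab(1) ax ya yx xy l'(3) by blast
    moreover have "valid (l' @ [x])" using l'(1) \<open>x \<in> {1..n}\<close> by (simp add: valid_def)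
    moreover have "insert a (insert y (set (l' @ [x]))) = W" using l(2) l'(2) by auto
    ultimately show ?thesis unfolding P_def by blast
  qed
  have "\<not> connected_on E W"
  proof
    assume "connected_on E W"
    then have "(\<lambda>x y. x \<in> W \<and> y \<in> W \<and> E x y)\<^sup>*\<^sup>* b a" by (auto simp: connected_on_def W_def)
    moreover have "P b" unfolding P_def W_def using l nz by blast
    ultimately have "P a" by (induction rule: rtranclp_induct) (use step in blast)+
    then show False using edge_coeff unfolding P_def by blast
  qed
  then show ?thesis using W card by blast
qed

end

section \<open>A cycle from a disconnected vertex set\<close>

text \<open>The sign of the sorting permutation, as -1 to the number of inversions, and 0 on lists
  with repetitions.\<close>

primrec alt_sign :: "nat list \<Rightarrow> 'k::comm_ring_1" where
  "alt_sign [] = 1"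
| "alt_sign (a # l) = (if a \<in> set l then 0 else (- 1) ^ card {b \<in> set l. b < a} * alt_sign l)"

text \<open>Exchanging neighbours reverses only the comparison between the two; the entries of the
  prefix see the same set behind them.\<close>

lemma alt_sign_swap: "alt_sign (xs @ a # b # ys) = - (alt_sign (xs @ b # a # ys) :: 'k::comm_ring_1)"
proof (induction xs)
  case Nil
  have less_insert: "card {c \<in> insert y S. c < x} = (if y < x then Suc (card {c \<in> S. c < x}) else card {c \<in> S. c < x})"
    if "finite S" "y \<notin> S" for S and x y :: nat
  proof (cases "y < x")
    case True
    then have "{c \<in> insert y S. c < x} = insert y {c \<in> S. c < x}" by auto
    then show ?thesis using that True by simp
  next
    case False
    then have "{c \<in> insert y S. c < x} = {c \<in> S. c < x}" by auto
    then show ?thesis using False by simp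
  qed
  show ?case
  proof (cases "a = b \<or> a \<in> set ys \<or> b \<in> set ys")
    case False
    then have "card {c \<in> insert b (set ys). c < a} = (if b < a then Suc (card {c \<in> set ys. c < a}) else card {c \<in> set ys. c < a})"
      "card {c \<in> insert a (set ys). c < b} = (if a < b then Suc (card {c \<in> set ys. c < b}) else card {c \<in> set ys. c < b})"
      by (intro less_insert; simp)+
    then show ?thesis using False by (cases "a < b") auto
  qed auto
next
  case (Cons x xs)
  have "set (xs @ a # b # ys) = set (xs @ b # a # ys)" by auto
  then show ?case using Cons by simp
qed

lemma alt_sign_nonzero: "distinct l \<Longrightarrow> alt_sign l \<noteq> (0 :: 'k::field)"
  by (induction l) simp_all

text \<open>The Koszul differential applied twice to the volume form of \<open>W\<close>, with the indicator function of \<open>A\<close>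
  inserted in between; the contributions with both indices in \<open>A\<close> cancel.\<close>

lemma ex_koszul_cycle:
  assumes E: "graph_on n E" and W: "W \<subseteq> {1..n}" "card W = i + 2" "\<not> connected_on E W"
  shows "\<exists>f :: nat list \<Rightarrow> 'k::field_char_0 mpoly. koszul_cycle n (clique_complex n E) i f \<and>
    (\<exists>l. length l = i \<and> set l \<subseteq> {1..n} \<and> f l \<noteq> 0)"
proof -
  let ?R = "\<lambda>x y. x \<in> W \<and> y \<in> W \<and> E x y"
  obtain u0 v0 where uv: "u0 \<in> W" "v0 \<in> W" "\<not> ?R\<^sup>*\<^sup>* u0 v0"
    using W(3) by (auto simp: connected_on_def)
  \<comment> \<open>The component of \<open>u0\<close>: no edge leads from it to the rest of
    W.\<close>
  define A where "A = {v \<in> W. ?R\<^sup>*\<^sup>* u0 v}"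
  have finW: "finite W" using W(1) finite_subset by blast
  then have fin: "finite A" "finite (W - A)" by (simp_all add: A_def)
  have AW: "A \<subseteq> W" "u0 \<in> A" "v0 \<in> W - A" using uv by (auto simp: A_def)
  have no_edge: "\<not> E v u" if "v \<in> A" "u \<in> W - A" for u v
  proof
    assume "E v u"
    then have "?R v u" using that AW(1) by auto
    then have "?R\<^sup>*\<^sup>* u0 u" using that(1) unfolding A_def by (metis (no_types, lifting) mem_Collect_eq rtranclp.rtrancl_into_rtrancl)
    then show False using that(2) by (auto simp: A_def)
  qed
  define \<epsilon> where "\<epsilon> l = (if set l = W then alt_sign l else (0 :: 'k))" for l
  have \<epsilon>_swap: "\<epsilon> (xs @ a # b # ys) = - \<epsilon> (xs @ b # a # ys)" for xs a b ys
  proof -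
    have "set (xs @ a # b # ys) = set (xs @ b # a # ys)" by auto
    then show ?thesis unfolding \<epsilon>_def using alt_sign_swap[of xs a b ys, where ?'k = 'k] by simp
  qed
  \<comment> \<open>Letting u range over all of W makes the cycle condition a Koszul identity in s
    and u; the equivalent form \<open>f_eq\<close>, with u outside A, shows that only nonadjacent
    pairs occur as monomials.\<close>
  define f where "f l = (\<Sum>u\<in>W. \<Sum>v\<in>A. var_poly u * (var_poly v * Poly_Mapping.single 0 (\<epsilon> (l @ [u, v]))))" for l
  have f_eq: "f l = (\<Sum>u\<in>W - A. \<Sum>v\<in>A. Poly_Mapping.single (edge_mon u v) (\<epsilon> (l @ [u, v])))" for l
  proof -
    have "(\<Sum>u\<in>A. \<Sum>v\<in>A. var_poly u * (var_poly v * Poly_Mapping.single 0 (\<epsilon> (l @ [u, v])))) = 0"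
      unfolding quadratic_form_eq_0_iff[OF fin(1)] using \<epsilon>_swap[of l _ _ "[]"] by blast
    then show ?thesis
      unfolding f_def sum.subset_diff[OF AW(1) finW] by (simp add: mult_single)
  qed
  have f_coeff: "Poly_Mapping.keys m \<subseteq> {1..n} \<and> Poly_Mapping.keys m \<notin> clique_complex n E \<and> mon_deg m = 2"
    if nz: "Poly_Mapping.lookup (f l) m \<noteq> 0" for l m
  proof -
    from nz obtain u where u: "u \<in> W - A" "(\<Sum>v\<in>A. Poly_Mapping.lookup (Poly_Mapping.single (edge_mon u v) (\<epsilon> (l @ [u, v]))) m) \<noteq> 0"
      unfolding f_eq lookup_sum by (meson sum.not_neutral_contains_not_neutral)
    then obtain v where v: "v \<in> A" "Poly_Mapping.lookup (Poly_Mapping.single (edge_mon u v) (\<epsilon> (l @ [u, v]))) m \<noteq> 0"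
      by (meson sum.not_neutral_contains_not_neutral)
    then have m: "m = edge_mon u v" by (metis lookup_single_not_eq)
    have "u \<noteq> v" using u(1) v(1) by blast
    moreover have "\<not> E v u" using no_edge u(1) v(1) by blast
    ultimately have "{u, v} \<notin> clique_complex n E" by (auto simp: clique_complex_def)
    moreover have "{u, v} \<subseteq> {1..n}" using u(1) v(1) AW(1) W(1) by blast
    ultimately show ?thesis unfolding m keys_edge_mon by (simp add: mon_deg_add)
  qed
  have "koszul_cycle n (clique_complex n E) i f"
    unfolding koszul_cycle_def
  proof (intro conjI allI impI)
    fix l
    show "f l \<in> nonface_ideal n (clique_complex n E)"
      using f_coeff[of l] by (auto simp: nonface_ideal_def poly_ring_iff in_keys_iff)
    show "mon_deg m = 2" if "Poly_Mapping.lookup (f l) m \<noteq> 0" for m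
      using f_coeff[OF that] by blast
  next
    fix xs a b ys
    have "\<epsilon> (xs @ a # b # ys @ [u, v]) = - \<epsilon> (xs @ b # a # ys @ [u, v])" for u v
      by (rule \<epsilon>_swap)
    then show "f (xs @ a # b # ys) = - f (xs @ b # a # ys)"
      unfolding f_def by (simp add: single_uminus sum_negf)
  next
    fix l
    \<comment> \<open>For fixed v the quadratic form in s and u has antisymmetric coefficients, so
      it vanishes.\<close>
    have quad: "(\<Sum>s\<in>W. \<Sum>u\<in>W. var_poly s * (var_poly u * Poly_Mapping.single 0 (\<epsilon> (l @ [s, u, v])))) = 0" for v
      unfolding quadratic_form_eq_0_iff[OF finW] using \<epsilon>_swap[of l _ _ "[v]"] by blast
    have "f (l @ [s]) = 0" if "s \<notin> W" for s
    proof -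
      have "\<epsilon> (l @ [s, u, v]) = 0" for u v using that by (auto simp: \<epsilon>_def)
      then show ?thesis by (simp add: f_def)
    qed
    then have "(\<Sum>s\<in>{1..n}. var_poly s * f (l @ [s])) = (\<Sum>s\<in>W. var_poly s * f (l @ [s]))"
      by (intro sum.mono_neutral_right) (use W(1) in auto)
    also have "\<dots> = (\<Sum>s\<in>W. \<Sum>v\<in>A. \<Sum>u\<in>W. var_poly v * (var_poly s * (var_poly u * Poly_Mapping.single 0 (\<epsilon> (l @ [s, u, v])))))"
    proof (intro sum.cong refl)
      fix s
      have "var_poly s * f (l @ [s]) = (\<Sum>u\<in>W. \<Sum>v\<in>A. var_poly v * (var_poly s * (var_poly u * Poly_Mapping.single 0 (\<epsilon> (l @ [s, u, v])))))"
        unfolding f_def sum_distrib_left by (intro sum.cong refl) (simp add: mult_single add_ac)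
      also have "\<dots> = (\<Sum>v\<in>A. \<Sum>u\<in>W. var_poly v * (var_poly s * (var_poly u * Poly_Mapping.single 0 (\<epsilon> (l @ [s, u, v])))))"
        by (rule sum.swap)
      finally show "var_poly s * f (l @ [s]) = (\<Sum>v\<in>A. \<Sum>u\<in>W. var_poly v * (var_poly s * (var_poly u * Poly_Mapping.single 0 (\<epsilon> (l @ [s, u, v])))))" .
    qed
    also have "\<dots> = (\<Sum>v\<in>A. var_poly v * (\<Sum>s\<in>W. \<Sum>u\<in>W. var_poly s * (var_poly u * Poly_Mapping.single 0 (\<epsilon> (l @ [s, u, v])))))"
      unfolding sum_distrib_left by (rule sum.swap)
    also have "\<dots> = 0" unfolding quad by simp
    finally show "(\<Sum>s\<in>{1..n}. var_poly s * f (l @ [s])) = 0" .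
  qed
  moreover
  \<comment> \<open>Listing all other vertices as indices leaves \<open>u0\<close> and
    \<open>v0\<close> for the monomial.\<close>
  define l where "l = sorted_list_of_set (W - {u0, v0})"
  have l: "set l = W - {u0, v0}" "distinct l" using finW by (simp_all add: l_def)
  have "u0 \<noteq> v0" using AW by blast
  then have "length l = i"
    using l W(2) finW uv(1,2) by (metis card_Diff_subset card_2_iff diff_add_inverse2 distinct_card empty_subsetI finite.emptyI finite.insertI insert_subset)
  moreover have "set l \<subseteq> {1..n}" using l W(1) by blast
  moreover have "f l \<noteq> 0"
  proof
    assume "f l = 0"
    then have "0 = Poly_Mapping.lookup (f l) (edge_mon v0 u0)" by simp
    \<comment> \<open>The opposite assignment u = u0, v = v0 is impossible, since \<open>u0\<close>
      lies in A and \<open>v0\<close> does not; nothing can cancel the one remaining term.\<close>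
    also have "\<dots> = (\<Sum>u\<in>W - A. \<Sum>v\<in>A. if u = v0 \<and> v = u0 then \<epsilon> (l @ [v0, u0]) else 0)"
      unfolding f_eq lookup_sum lookup_single when_def single_add_single_eq_iff
      using AW by (intro sum.cong) auto
    also have "\<dots> = (\<Sum>u\<in>W - A. if u = v0 then (\<Sum>v\<in>A. if v = u0 then \<epsilon> (l @ [v0, u0]) else 0) else 0)"
      by (intro sum.cong) auto
    also have "\<dots> = \<epsilon> (l @ [v0, u0])" using AW fin by simp
    also have "\<epsilon> (l @ [v0, u0]) = alt_sign (l @ [v0, u0])"
      using l uv by (auto simp: \<epsilon>_def)
    finally have "alt_sign (l @ [v0, u0]) = (0 :: 'k)" by simp
    moreover have "distinct (l @ [v0, u0])" using l \<open>u0 \<noteq> v0\<close> by auto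
    ultimately show False using alt_sign_nonzero by blast
  qed
  ultimately show ?thesis by blast
qed

subsection \<open>The connectivity criterion\<close>

lemma betti_linear_strand_eq_0_iff:
  assumes E: "graph_on n E"
  shows "betti n (SR_ideal n (clique_complex n E) :: 'k::field_char_0 mpoly set) i (i + 1) = 0 \<longleftrightarrow>
    (\<forall>W\<subseteq>{1..n}. card W = i + 1 \<longrightarrow> connected_on E W)"
proof -
  let ?\<Gamma> = "clique_complex n E"
  have down: "S \<in> ?\<Gamma> \<Longrightarrow> T \<subseteq> S \<Longrightarrow> T \<in> ?\<Gamma>" for S T by (auto simp: clique_complex_def)
  have small: "S \<in> ?\<Gamma>" if "S \<subseteq> {1..n}" "card S \<le> 1" for S
  proof -
    have "finite S" using that(1) finite_subset by blast
    then have "u = v" if "u \<in> S" "v \<in> S" for u v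
      using that \<open>card S \<le> 1\<close> by (metis One_nat_def card_le_Suc0_iff_eq)
    then show ?thesis using that(1) by (auto simp: clique_complex_def)
  qed
  define F where "F = (SOME F :: 'k gres. min_graded_free_res n (SR_ideal n ?\<Gamma>) F)"
  have SR: "(SR_ideal n ?\<Gamma> :: 'k mpoly set) = nonface_ideal n ?\<Gamma>" by (rule SR_ideal_eq) (rule down)
  have "\<exists>F :: 'k gres. min_graded_free_res n (nonface_ideal n ?\<Gamma>) F"
    using down small[of "{}"] by (intro ex_min_graded_free_res) auto
  then have res: "min_graded_free_res n (nonface_ideal n ?\<Gamma>) F"
    unfolding F_def SR by (rule someI_ex)
  interpret flag_resolution n ?\<Gamma> F by unfold_locales (fact res small)+
  have betti: "betti n (SR_ideal n ?\<Gamma> :: 'k mpoly set) i (i + 1) = card {c. c < rk F i \<and> sh F i c = i + 1}"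
    by (simp add: betti_def F_def Let_def)
  show ?thesis
  proof (cases i)
    case 0
    \<comment> \<open>Here both sides are true: module 0 has its only generator in degree 0, and a
      single vertex is connected.\<close>
    have "{c. c < rk F 0 \<and> sh F 0 c = 1} = {}" using rk_0 sh_0 by auto
    moreover have "connected_on E W" if "card W = 1" for W
      using that by (auto simp: connected_on_def card_1_singleton_iff)
    ultimately show ?thesis using betti by (simp add: 0)
  next
    case (Suc j)
    have "betti n (SR_ideal n ?\<Gamma> :: 'k mpoly set) i (i + 1) \<noteq> 0 \<longleftrightarrow>
        (\<exists>f :: nat list \<Rightarrow> 'k mpoly. koszul_cycle n ?\<Gamma> j f \<and> (\<exists>l. length l = j \<and> set l \<subseteq> {1..n} \<and> f l \<noteq> 0))"
      using linear_strand_nonzero_iff[of j] betti by (simp add: Suc)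
    also have "\<dots> \<longleftrightarrow> (\<exists>W\<subseteq>{1..n}. card W = j + 2 \<and> \<not> connected_on E W)"
    proof
      assume "\<exists>f :: nat list \<Rightarrow> 'k mpoly. koszul_cycle n ?\<Gamma> j f \<and> (\<exists>l. length l = j \<and> set l \<subseteq> {1..n} \<and> f l \<noteq> 0)"
      then obtain f :: "nat list \<Rightarrow> 'k mpoly" and l where f: "koszul_cycle n ?\<Gamma> j f"
        and l: "length l = j" "set l \<subseteq> {1..n}" "f l \<noteq> 0" by blast
      interpret clique_koszul_cycle n E j f by unfold_locales (fact E f)+
      show "\<exists>W\<subseteq>{1..n}. card W = j + 2 \<and> \<not> connected_on E W"
        using ex_disconnected l by (simp add: valid_def)
    qed (use ex_koszul_cycle[OF E] in blast)
    finally show ?thesis unfolding Suc by auto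
  qed
qed

theorem theorem3p1:
  fixes n :: nat and E :: "nat \<Rightarrow> nat \<Rightarrow> bool"
  assumes "graph_on n E"
  shows "(\<forall>k\<le>n. k_connected n E k \<longleftrightarrow>
            (\<forall>i\<ge>n - k. betti n (SR_ideal n (clique_complex n E) :: ('k::field_char_0) mpoly set) i (i + 1) = 0))
       \<and> vertex_connectivity n E =
           Max {k \<in> {0..n}. \<forall>i\<ge>n - k.
                  betti n (SR_ideal n (clique_complex n E) :: 'k mpoly set) i (i + 1) = 0}"
proof -
  have iff: "k_connected n E k \<longleftrightarrow>
      (\<forall>i\<ge>n - k. betti n (SR_ideal n (clique_complex n E) :: 'k mpoly set) i (i + 1) = 0)"
    if k: "k \<le> n" for k
    unfolding betti_linear_strand_eq_0_iff[OF assms]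
  proof
    assume conn: "k_connected n E k"
    show "\<forall>i\<ge>n - k. \<forall>W\<subseteq>{1..n}. card W = i + 1 \<longrightarrow> connected_on E W"
    proof (intro allI impI)
      fix i W assume i: "n - k \<le> i" and W: "W \<subseteq> {1..n}" "card W = i + 1"
      have "card ({1..n} - W) = n - (i + 1)"
        using W by (simp add: card_Diff_subset finite_subset)
      moreover have "i + 1 \<le> n" using card_mono[OF _ W(1)] W(2) by simp
      \<comment> \<open>The complement of W serves as the removed set.\<close>
      ultimately have "card ({1..n} - W) < k" using i by linarith
      then have "connected_on E ({1..n} - ({1..n} - W))"
        using conn unfolding k_connected_def by blast
      moreover have "{1..n} - ({1..n} - W) = W" using W(1) by blast
      ultimately show "connected_on E W" by simp
    qed
  next
    assume conn: "\<forall>i\<ge>n - k. \<forall>W\<subseteq>{1..n}. card W = i + 1 \<longrightarrow> connected_on E W"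
    show "k_connected n E k"
      unfolding k_connected_def
    proof (intro conjI allI impI k; elim conjE)
      fix X assume X: "X \<subseteq> {1..n}" "card X < k"
      have "card ({1..n} - X) = n - card X"
        using X by (simp add: card_Diff_subset finite_subset)
      \<comment> \<open>Because \<open>card X < k\<close> and \<open>k \<le> n\<close>, some vertex
        remains, so the truncated subtraction is exact.\<close>
      then have "card ({1..n} - X) = (n - card X - 1) + 1" "n - k \<le> n - card X - 1"
        using X(2) k by linarith+
      then show "connected_on E ({1..n} - X)" using conn by blast
    qed
  qed
  define K where "K = {k \<in> {0..n}. \<forall>i\<ge>n - k.
    betti n (SR_ideal n (clique_complex n E) :: 'k mpoly set) i (i + 1) = 0}"
  have K_iff: "k \<in> K \<longleftrightarrow> k_connected n E k" for k
    using iff[of k] by (auto simp: K_def k_connected_def)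
  have "finite K" by (simp add: K_def)
  \<comment> \<open>0-connectedness is vacuous; it guarantees that the maximum is taken over a
    nonempty set.\<close>
  have "0 \<in> K" by (simp add: K_iff k_connected_def)
  have "vertex_connectivity n E = Max K"
    unfolding vertex_connectivity_def
  proof (rule Greatest_equality)
    show "k_connected n E (Max K)"
      using Max_in[OF \<open>finite K\<close>] \<open>0 \<in> K\<close> K_iff by blast
    show "k \<le> Max K" if "k_connected n E k" for k
      using that \<open>finite K\<close> by (simp add: Max_ge K_iff)
  qed
  then show ?thesis unfolding K_def using iff by blast
qed

end
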